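(* Let $\lambda_0=\sqrt{1/3}$, $\lambda_1=\sqrt{2/3}$, and let $u,v>0$ be real with $u^2+v^2=1$ and $\frac23<u^2<1$. Then the quantum distribution $P_Q^{333}(a,b,c)$, $a,b,c\in\{\bar 0,\bar 1_0,\bar 1_1\}$, obtained in the triangle network from the two-qubit states $|\psi\rangle=\lambda_0|01\rangle+\lambda_1|10\rangle$ and the three-outcome measurements with parameters $u,v$ (as defined in the context) is not triangle-local.
   Context: Triangle-local: a distribution $P(a,b,c)$ is triangle-local if there are independent random variables $\alpha,\beta,\gamma$ (with arbitrary distributions) and conditional distributions $P_A(a|\beta,\gamma)$, $P_B(b|\gamma,\alpha)$, $P_C(c|\alpha,\beta)$ such that $P(a,b,c)=\int d\mu(\alpha)\,d\eta(\beta)\,d\nu(\gamma)\,P_A(a|\beta,\gamma)P_B(b|\gamma,\alpha)P_C(c|\alpha,\beta)$, where $\mu,\eta,\nu$ are the distributions of $\alpha,\beta,\gamma$. Quantum distribution: party $A$ holds qubits $A_1A_2$, party $B$ holds $B_1B_2$, party $C$ holds $C_1C_2$. The global state is $|\Psi\rangle=|\psi\rangle_{A_2B_1}\otimes|\psi\rangle_{B_2C_1}\otimes|\psi\rangle_{C_2A_1}$ with $|\psi\rangle=\lambda_0|01\rangle+\lambda_1|10\rangle$. Each party measures its two qubits (in the order $A_1A_2$, $B_1B_2$, $C_1C_2$) with the projectors $\Pi_{\bar 0}=|00\rangle\langle00|+|11\rangle\langle11|$, $\Pi_{\bar 1_0}=|\bar1_0\rangle\langle\bar1_0|$, $\Pi_{\bar1_1}=|\bar1_1\rangle\langle\bar1_1|$,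 where $|\bar1_0\rangle=u|01\rangle+v|10\rangle$ and $|\bar1_1\rangle=v|01\rangle-u|10\rangle$. The distribution is $P_Q^{333}(a,b,c)=\langle\Psi|\Pi_a\otimes\Pi_b\otimes\Pi_c|\Psi\rangle$. Explicitly, with $u_0=u$, $v_0=v$, $u_1=v$, $v_1=-u$ and $i,j,k\in\{0,1\}$: $P(\bar1_i,\bar0,\bar0)=P(\bar0,\bar1_i,\bar0)=P(\bar0,\bar0,\bar1_i)=\lambda_1^4\lambda_0^2u_i^2+\lambda_0^4\lambda_1^2v_i^2$; $P(\bar1_i,\bar1_j,\bar1_k)=(\lambda_1^3u_iu_ju_k+\lambda_0^3v_iv_jv_k)^2$; and all other probabilities (no output $\bar1$, or exactly two outputs of type $\bar1$) are $0$. *)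

theory Defs
  imports "HOL-Probability.Probability"
begin

section \<open>Triangle-local distributions\<close>

text \<open>
  A conditional distribution such as $P_A(a \mid \beta,\gamma)$ is a family of probability mass
  functions, each of whose values depends measurably on the two sources.  The independence of the
  sources is expressed by the product measure.

  Existential quantification over types is not available, so the types of the values of the three
  sources are parameters.  ``Not triangle-local'' is the negation for all choices of these types,
  that is, with \<open>'x\<close>, \<open>'y\<close> and \<open>'z\<close> left as type variables.
\<close>

definition triangle_local ::
    "'x itself \<Rightarrow> 'y itself \<Rightarrow> 'z itself \<Rightarrow> ('a \<Rightarrow> 'b \<Rightarrow> 'c \<Rightarrow> real) \<Rightarrow> bool" where
  "triangle_local _ _ _ P \<longleftrightarrow>
    (\<exists>(\<mu> :: 'x measure) (\<eta> :: 'y measure) (\<nu> :: 'z measure)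
      (P\<^sub>A :: 'y \<Rightarrow> 'z \<Rightarrow> 'a pmf) (P\<^sub>B :: 'z \<Rightarrow> 'x \<Rightarrow> 'b pmf) (P\<^sub>C :: 'x \<Rightarrow> 'y \<Rightarrow> 'c pmf).
      prob_space \<mu> \<and> prob_space \<eta> \<and> prob_space \<nu> \<and>
      (\<forall>a. (\<lambda>(\<beta>, \<gamma>). pmf (P\<^sub>A \<beta> \<gamma>) a) \<in> borel_measurable (\<eta> \<Otimes>\<^sub>M \<nu>)) \<and>
      (\<forall>b. (\<lambda>(\<gamma>, \<alpha>). pmf (P\<^sub>B \<gamma> \<alpha>) b) \<in> borel_measurable (\<nu> \<Otimes>\<^sub>M \<mu>)) \<and>
      (\<forall>c. (\<lambda>(\<alpha>, \<beta>). pmf (P\<^sub>C \<alpha> \<beta>) c) \<in> borel_measurable (\<mu> \<Otimes>\<^sub>M \<eta>)) \<and>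
      (\<forall>a b c. P a b c =
        (\<integral>(\<alpha>, \<beta>, \<gamma>). pmf (P\<^sub>A \<beta> \<gamma>) a * pmf (P\<^sub>B \<gamma> \<alpha>) b * pmf (P\<^sub>C \<alpha> \<beta>) c
          \<partial>(\<mu> \<Otimes>\<^sub>M (\<eta> \<Otimes>\<^sub>M \<nu>)))))"

section \<open>Vectors and operators on finite-dimensional Hilbert spaces\<close>

text \<open>
  The space \<open>complex ^ 'n\<close> has the computational basis indexed by \<open>'n\<close>, and the tensor product of
  \<open>complex ^ 'm\<close> and \<open>complex ^ 'n\<close> is \<open>complex ^ ('m \<times> 'n)\<close>.  A qubit has index type \<open>2\<close>, whose
  elements are \<open>0\<close> and \<open>1\<close>.
\<close>

definition ket :: "2 \<Rightarrow> 2 \<Rightarrow> complex ^ (2 \<times> 2)" where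
  "ket i j = axis (i, j) 1"

definition braket :: "complex ^ 'n \<Rightarrow> complex ^ 'n \<Rightarrow> complex" where
  "braket x y = (\<Sum>i\<in>UNIV. cnj (x $ i) * y $ i)"

definition ketbra :: "complex ^ 'm \<Rightarrow> complex ^ 'n \<Rightarrow> complex ^ 'n ^ 'm" where
  "ketbra x y = (\<chi> i j. x $ i * cnj (y $ j))"

definition tensor_op ::
    "complex ^ 'm ^ 'm \<Rightarrow> complex ^ 'n ^ 'n \<Rightarrow> complex ^ ('m \<times> 'n) ^ ('m \<times> 'n)" where
  "tensor_op M N = (\<chi> i j. M $ fst i $ fst j * N $ snd i $ snd j)"

section \<open>The quantum distribution in the triangle network\<close>

datatype outcome = Bar0 | Bar1_0 | Bar1_1

definition \<psi> :: "real \<Rightarrow> real \<Rightarrow> complex ^ (2 \<times> 2)" where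
  "\<psi> l\<^sub>0 l\<^sub>1 = l\<^sub>0 *\<^sub>R ket 0 1 + l\<^sub>1 *\<^sub>R ket 1 0"

text \<open>
  The qubits are grouped by party, in the order $A_1A_2$, $B_1B_2$, $C_1C_2$, whereas the three
  shared states live on $A_2B_1$, $B_2C_1$ and $C_2A_1$.
\<close>

definition \<Psi> :: "real \<Rightarrow> real \<Rightarrow> complex ^ ((2 \<times> 2) \<times> (2 \<times> 2) \<times> (2 \<times> 2))" where
  "\<Psi> l\<^sub>0 l\<^sub>1 = vec_lambda (\<lambda>((a\<^sub>1, a\<^sub>2), (b\<^sub>1, b\<^sub>2), (c\<^sub>1, c\<^sub>2)).
     \<psi> l\<^sub>0 l\<^sub>1 $ (a\<^sub>2, b\<^sub>1) * \<psi> l\<^sub>0 l\<^sub>1 $ (b\<^sub>2, c\<^sub>1) * \<psi> l\<^sub>0 l\<^sub>1 $ (c\<^sub>2, a\<^sub>1))"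

definition ket_bar1_0 :: "real \<Rightarrow> real \<Rightarrow> complex ^ (2 \<times> 2)" where
  "ket_bar1_0 u v = u *\<^sub>R ket 0 1 + v *\<^sub>R ket 1 0"

definition ket_bar1_1 :: "real \<Rightarrow> real \<Rightarrow> complex ^ (2 \<times> 2)" where
  "ket_bar1_1 u v = v *\<^sub>R ket 0 1 - u *\<^sub>R ket 1 0"

fun Proj :: "real \<Rightarrow> real \<Rightarrow> outcome \<Rightarrow> complex ^ (2 \<times> 2) ^ (2 \<times> 2)" where
  "Proj u v Bar0 = ketbra (ket 0 0) (ket 0 0) + ketbra (ket 1 1) (ket 1 1)"
| "Proj u v Bar1_0 = ketbra (ket_bar1_0 u v) (ket_bar1_0 u v)"
| "Proj u v Bar1_1 = ketbra (ket_bar1_1 u v) (ket_bar1_1 u v)"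

text \<open>
  The operators are Hermitian, so the expectation value is real and \<open>Re\<close> merely changes its type.
\<close>

definition P_Q333 ::
    "real \<Rightarrow> real \<Rightarrow> real \<Rightarrow> real \<Rightarrow> outcome \<Rightarrow> outcome \<Rightarrow> outcome \<Rightarrow> real" where
  "P_Q333 l\<^sub>0 l\<^sub>1 u v a b c =
     Re (braket (\<Psi> l\<^sub>0 l\<^sub>1)
       (tensor_op (Proj u v a) (tensor_op (Proj u v b) (Proj u v c)) *v \<Psi> l\<^sub>0 l\<^sub>1))"

end

theory Submission
  imports Defs
begin

text \<open>
  The number of outputs of type $\bar 1$ is odd almost surely.  Hence the types are
  deterministic, and fixing one value of $\alpha$ shows that they are products $fg$, $gh$, $hf$ of
  signs $f(\beta)$, $g(\gamma)$, $h(\alpha)$.  Since each product has mean $1/9$, the signs can be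
  chosen with mean $1/3$, so that $f = g = h = -1$ has probability $1/27$.  Independence
  of $h$ from $(\beta,\gamma)$ turns $P(\bar1_0,\bar0,\bar0)$ and $\sum_{jk} P(\bar1_0,\bar1_j,\bar1_k)$
  into two linear equations, which yield $v^2/27$ for the probability of $a = \bar1_0$ and
  $f = g = h = -1$; likewise for the other parties.  By the union bound
  $P(\bar1_1,\bar1_1,\bar1_1) \ge (1 - 3v^2)/27$, which is false for $2/3 < u^2 < 1$.
\<close>

section \<open>The quantum distribution\<close>

definition tensor_vec :: "complex ^ 'm \<Rightarrow> complex ^ 'n \<Rightarrow> complex ^ ('m \<times> 'n)" where
  "tensor_vec x y = (\<chi> i. x $ fst i * y $ snd i)"

lemma tensor_op_ketbra:
  "tensor_op (ketbra x x') (ketbra y y') = ketbra (tensor_vec x y) (tensor_vec x' y')"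
  by (simp add: tensor_op_def ketbra_def tensor_vec_def vec_eq_iff)

lemma tensor_op_add_left: "tensor_op (M + M') N = tensor_op M N + tensor_op M' N"
  by (simp add: tensor_op_def vec_eq_iff distrib_right)

lemma tensor_op_add_right: "tensor_op M (N + N') = tensor_op M N + tensor_op M N'"
  by (simp add: tensor_op_def vec_eq_iff distrib_left)

lemma braket_add_right: "braket x (y + z) = braket x y + braket x z"
  by (simp add: braket_def sum.distrib distrib_left)

text \<open>For a rank-one operator the expectation is the squared modulus of one amplitude. Every
  \<open>Proj\<close> is a sum of operators \<open>ketbra w w\<close>, so by bilinearity of
  \<open>tensor_op\<close> each probability becomes a sum of such squares.\<close>

lemma expectation_ketbra: "Re (braket x (ketbra w w *v x)) = (cmod (braket w x))\<^sup>2"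
proof -
  have "ketbra w w *v x = (\<chi> i. w $ i * braket w x)"
    by (simp add: ketbra_def braket_def matrix_vector_mult_def vec_eq_iff sum_distrib_left mult.assoc)
  moreover have "braket x (\<chi> i. w $ i * c) = cnj (braket w x) * c" for c
    by (simp add: braket_def sum_distrib_left mult_ac)
  ultimately have "braket x (ketbra w w *v x) = cnj (braket w x) * braket w x"
    by simp
  then show ?thesis
    by (metis complex_mod_mult_cnj Re_complex_of_real complex_norm_square mult.commute)
qed

lemma psi_nth:
  "\<psi> l\<^sub>0 l\<^sub>1 $ (0, 0) = 0" "\<psi> l\<^sub>0 l\<^sub>1 $ (1, 1) = 0" "\<psi> l\<^sub>0 l\<^sub>1 $ (0, 1) = l\<^sub>0" "\<psi> l\<^sub>0 l\<^sub>1 $ (1, 0) = l\<^sub>1"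
  by (auto simp: \<psi>_def ket_def axis_def scaleR_conv_of_real[where 'a = complex])

lemma UNIV_2_zero_one: "(UNIV :: 2 set) = {0, 1}"
  using UNIV_2 by auto

lemma sum_qubits: "(\<Sum>i\<in>UNIV. F i) = F (0,0) + F (0,1) + F (1,0) + F (1,1)" for F :: "2 \<times> 2 \<Rightarrow> complex"
  by (simp add: UNIV_Times_UNIV[symmetric] sum.cartesian_product[symmetric] UNIV_2_zero_one add.assoc del: UNIV_Times_UNIV)

lemma sum_pair: "(\<Sum>i\<in>UNIV. F i) = (\<Sum>i\<in>UNIV. \<Sum>j\<in>UNIV. F (i, j))"
   for F :: "'m::finite \<times> 'n::finite \<Rightarrow> complex"
  by (simp add: UNIV_Times_UNIV[symmetric] sum.cartesian_product del: UNIV_Times_UNIV)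

text \<open>Each of the three shared pairs is in state 01 or 10, so only eight basis configurations
  have an amplitude. The coefficients are real, which allows the conjugation in
  \<open>braket\<close> to be moved outside the sum.\<close>

lemma braket_tensor_Psi:
  "braket (tensor_vec x (tensor_vec y z)) (\<Psi> l\<^sub>0 l\<^sub>1) =
    cnj (l\<^sub>0 ^ 3 * x $ (1,0) * y $ (1,0) * z $ (1,0)
    + l\<^sub>0\<^sup>2 * l\<^sub>1 * x $ (1,1) * y $ (0,0) * z $ (1,0)
    + l\<^sub>0\<^sup>2 * l\<^sub>1 * x $ (1,0) * y $ (1,1) * z $ (0,0)
    + l\<^sub>0\<^sup>2 * l\<^sub>1 * x $ (0,0) * y $ (1,0) * z $ (1,1)
    + l\<^sub>0 * l\<^sub>1\<^sup>2 * x $ (1,1) * y $ (0,1) * z $ (0,0)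
    + l\<^sub>0 * l\<^sub>1\<^sup>2 * x $ (0,1) * y $ (0,0) * z $ (1,1)
    + l\<^sub>0 * l\<^sub>1\<^sup>2 * x $ (0,0) * y $ (1,1) * z $ (0,1)
    + l\<^sub>1 ^ 3 * x $ (0,1) * y $ (0,1) * z $ (0,1))"
  \<comment> \<open>The type instances split the sum by party only; \<open>sum_qubits\<close> then
    writes out each two-qubit sum.\<close>
  unfolding braket_def sum_pair[of "\<lambda>i::(2\<times>2)\<times>(2\<times>2)\<times>(2\<times>2). _ i"] sum_pair[of "\<lambda>i::(2\<times>2)\<times>(2\<times>2). _ i"] sum_qubits
  by (simp add: tensor_vec_def \<Psi>_def psi_nth power2_eq_square power3_eq_cube algebra_simps)

section \<open>Closed form of the outcome probabilities\<close>

lemma ket_nth: "ket i j $ (k, l) = (if i = k \<and> j = l then 1 else 0)"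
  by (simp add: ket_def axis_def)

lemma ket_bar_nth:
  "ket_bar1_0 u v $ (0, 0) = 0" "ket_bar1_0 u v $ (0, 1) = u"
  "ket_bar1_0 u v $ (1, 0) = v" "ket_bar1_0 u v $ (1, 1) = 0"
  "ket_bar1_1 u v $ (0, 0) = 0" "ket_bar1_1 u v $ (0, 1) = v"
  "ket_bar1_1 u v $ (1, 0) = - u" "ket_bar1_1 u v $ (1, 1) = 0"
  by (simp_all add: ket_bar1_0_def ket_bar1_1_def ket_nth scaleR_conv_of_real[where 'a = complex])

lemmas P_Q333_simps = P_Q333_def tensor_op_add_left tensor_op_add_right tensor_op_ketbra
  matrix_vector_mult_add_rdistrib braket_add_right expectation_ketbra braket_tensor_Psi ket_nth ket_bar_nth

text \<open>The coefficients $u_i$ and $v_i$, with the junk value $0$ at \<open>Bar0\<close>.\<close>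

fun bar_u :: "real \<Rightarrow> real \<Rightarrow> outcome \<Rightarrow> real" where
  "bar_u u v Bar0 = 0" | "bar_u u v Bar1_0 = u" | "bar_u u v Bar1_1 = v"

fun bar_v :: "real \<Rightarrow> real \<Rightarrow> outcome \<Rightarrow> real" where
  "bar_v u v Bar0 = 0" | "bar_v u v Bar1_0 = v" | "bar_v u v Bar1_1 = - u"

text \<open>Every shared pair contains exactly one 1, so there are three in all, and
  \<open>Bar0\<close> means that a party holds an even number of them. Hence the number of outputs
  other than \<open>Bar0\<close> is odd.\<close>

lemma P_Q333_zero:
  "P_Q333 l\<^sub>0 l\<^sub>1 u v Bar0 Bar0 Bar0 = 0"
  "i \<noteq> Bar0 \<Longrightarrow> j \<noteq> Bar0 \<Longrightarrow> P_Q333 l\<^sub>0 l\<^sub>1 u v i j Bar0 = 0"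
  "i \<noteq> Bar0 \<Longrightarrow> j \<noteq> Bar0 \<Longrightarrow> P_Q333 l\<^sub>0 l\<^sub>1 u v i Bar0 j = 0"
  "i \<noteq> Bar0 \<Longrightarrow> j \<noteq> Bar0 \<Longrightarrow> P_Q333 l\<^sub>0 l\<^sub>1 u v Bar0 i j = 0"
  by (cases i; cases j; simp add: P_Q333_simps)+

text \<open>Two configurations contribute. They leave the other two parties in orthogonal states, 00
  with 11 or 11 with 00, so their weights add without interference.\<close>

lemma P_Q333_one:
  assumes "i \<noteq> Bar0"
  shows
  "P_Q333 l\<^sub>0 l\<^sub>1 u v i Bar0 Bar0 = l\<^sub>1 ^ 4 * l\<^sub>0\<^sup>2 * (bar_u u v i)\<^sup>2 + l\<^sub>0 ^ 4 * l\<^sub>1\<^sup>2 * (bar_v u v i)\<^sup>2"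
  "P_Q333 l\<^sub>0 l\<^sub>1 u v Bar0 i Bar0 = l\<^sub>1 ^ 4 * l\<^sub>0\<^sup>2 * (bar_u u v i)\<^sup>2 + l\<^sub>0 ^ 4 * l\<^sub>1\<^sup>2 * (bar_v u v i)\<^sup>2"
  "P_Q333 l\<^sub>0 l\<^sub>1 u v Bar0 Bar0 i = l\<^sub>1 ^ 4 * l\<^sub>0\<^sup>2 * (bar_u u v i)\<^sup>2 + l\<^sub>0 ^ 4 * l\<^sub>1\<^sup>2 * (bar_v u v i)\<^sup>2"
  using assms by (cases i; simp add: P_Q333_simps norm_mult norm_power power_mult_distrib flip: power_mult)+

text \<open>Only the two configurations with all shared pairs in the same basis state survive. All
  three projectors have rank one, so the two amplitudes add before squaring.\<close>

lemma P_Q333_three: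
  assumes "i \<noteq> Bar0" "j \<noteq> Bar0" "k \<noteq> Bar0"
  shows "P_Q333 l\<^sub>0 l\<^sub>1 u v i j k =
   (l\<^sub>1 ^ 3 * bar_u u v i * bar_u u v j * bar_u u v k + l\<^sub>0 ^ 3 * bar_v u v i * bar_v u v j * bar_v u v k)\<^sup>2"
  using assms by (cases i; cases j; cases k)
    (simp_all add: P_Q333_simps add.commute norm_mult norm_power
      flip: of_real_mult of_real_power of_real_add of_real_minus of_real_diff)

text \<open>
  With $s = u^2$ this amounts to $(1 - s)(10 - 7s)^2 < 32 s^3$, an equality at $s = 2/3$.
\<close>

lemma all_ones_amplitude_bound:
  fixes u v :: real
  assumes "u > 0" "v > 0" "u\<^sup>2 + v\<^sup>2 = 1" "2 / 3 < u\<^sup>2" "u\<^sup>2 < 1"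
  shows "(sqrt (2/3) ^ 3 * v ^ 3 - sqrt (1/3) ^ 3 * u ^ 3)\<^sup>2 < (1 - 3 * v\<^sup>2) / 27"
proof -
  define s t where "s = u\<^sup>2" and "t = v\<^sup>2"
  have st: "t = 1 - s" "2/3 < s" "s < 1" using assms by (auto simp: s_def t_def)
  \<comment> \<open>The cube of \<open>c\<close> is the product of the two terms in the square to be
    bounded, that is, half its cross term.\<close>
  define c where "c = sqrt (2/3) * sqrt (1/3) * u * v"
  have c: "c > 0" using assms by (simp add: c_def)
  have c2: "c\<^sup>2 = 2/9 * s * t"
    by (simp add: c_def s_def t_def power_mult_distrib)
  have "(1 - s) * (10 - 7 * s)\<^sup>2 < 32 * s^3"
  proof -
    \<comment> \<open>Both factors are positive and decreasing on the interval, so they are bounded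
      by their values at 2/3, where the two sides of the claim agree.\<close>
    have "(1 - s) * (10 - 7 * s)\<^sup>2 \<le> (1/3) * (16/3)\<^sup>2"
      using st by (intro mult_mono power_mono) auto
    also have "\<dots> = 32 * (2/3)^3" by (simp add: power2_eq_square power3_eq_cube)
    also have "\<dots> < 32 * s^3" using st power_strict_mono[of "2/3" s 3] by simp
    finally show ?thesis .
  qed
  \<comment> \<open>The factor \<open>(1 - s)^3\<close> makes both sides squares up to 2916 = 54^2.
    The roots are the quantities to compare, since \<open>10 - 7 * s = 3 + 7 * t\<close> and
    \<open>t^2 * (3 + 7 * t) = 8 * t^3 + s^3 - (1 - 3 * t)\<close>.\<close>
  then have "(1 - s)^3 * ((1 - s) * (10 - 7 * s)\<^sup>2) < (1 - s)^3 * (32 * s^3)"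
    using st by (intro mult_strict_left_mono) auto
  moreover have "(c^3)\<^sup>2 = (2/9 * s * t)^3"
    unfolding c2[symmetric] by (simp flip: power_mult)
  moreover have "\<dots> = (1 - s)^3 * (32 * s^3) / 2916"
    unfolding st by (simp add: power_mult_distrib power_divide)
  moreover have "((1 - s)\<^sup>2 * (10 - 7 * s) / 54)\<^sup>2 = (1 - s)^3 * ((1 - s) * (10 - 7 * s)\<^sup>2) / 2916"
    by (simp add: power2_eq_square power3_eq_cube)
  ultimately have "((1 - s)\<^sup>2 * (10 - 7 * s) / 54)\<^sup>2 < (c^3)\<^sup>2"
    by linarith
  then have less: "(1 - s)\<^sup>2 * (10 - 7 * s) / 54 < c^3"
    by (rule power2_less_imp_less) (use c in simp)
  have swap: "(y ^ 3)\<^sup>2 = (y\<^sup>2) ^ 3" for y :: real by (simp flip: power_mult)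
  have l: "(sqrt (2/3) ^ 3)\<^sup>2 = 8/27" "(sqrt (1/3) ^ 3)\<^sup>2 = 1/27"
    unfolding swap by (simp_all add: power3_eq_cube del: real_sqrt_divide)
  have p: "(v ^ 3)\<^sup>2 = t^3" "(u ^ 3)\<^sup>2 = s^3"
    unfolding swap by (simp_all add: s_def t_def)
  have "(sqrt (2/3) ^ 3 * v ^ 3 - sqrt (1/3) ^ 3 * u ^ 3)\<^sup>2 = 8/27 * t^3 + 1/27 * s^3 - 2 * c^3"
    unfolding power2_diff power_mult_distrib l p by (simp add: c_def power_mult_distrib del: real_sqrt_divide)
  also have "\<dots> < 8/27 * t^3 + 1/27 * s^3 - (1 - s)\<^sup>2 * (10 - 7 * s) / 27" using less by simp
  also have "\<dots> = (1 - 3 * t) / 27"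
    unfolding st by (simp add: power2_eq_square power3_eq_cube field_simps)
  finally show ?thesis by (simp add: t_def)
qed

section \<open>Rigidity of the parities\<close>

lemma abs_mult_le_1: "\<bar>x\<bar> \<le> 1 \<Longrightarrow> \<bar>y\<bar> \<le> 1 \<Longrightarrow> \<bar>x * y\<bar> \<le> (1::real)"
  using mult_mono[of "\<bar>x\<bar>" 1 "\<bar>y\<bar>" 1] by (simp add: abs_mult)

text \<open>Read \<open>x\<close>, \<open>y\<close>, \<open>z\<close> as the probabilities of
  \<open>Bar0\<close> for fixed sources. The hypotheses exclude every even number of outputs of type
  bar 1, and choosing a vanishing factor in each product leaves only deterministic cases. The sign
  \<open>1 - 2 * x\<close> is -1 for output \<open>Bar0\<close> and 1 otherwise.\<close>

lemma deterministic_of_odd_parity: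
  fixes x y z :: real
  assumes "x * y * z = 0" "(1 - x) * (1 - y) * z = 0" "(1 - x) * y * (1 - z) = 0" "x * (1 - y) * (1 - z) = 0"
  shows "x \<in> {0, 1} \<and> y \<in> {0, 1} \<and> z \<in> {0, 1} \<and> (1 - 2 * x) * (1 - 2 * y) * (1 - 2 * z) = 1"
proof -
  have "x = 0 \<or> y = 0 \<or> z = 0" "x = 1 \<or> y = 1 \<or> z = 0" "x = 1 \<or> y = 0 \<or> z = 1" "x = 0 \<or> y = 1 \<or> z = 1"
    using assms by auto
  then show ?thesis by (elim disjE) simp_all
qed

section \<open>Integration over three independent sources\<close>

locale three_sources =
  alpha: prob_space \<mu> + beta: prob_space \<eta> + gamma: prob_space \<nu>
  for \<mu> :: "'x measure" and \<eta> :: "'y measure" and \<nu> :: "'z measure"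
begin

sublocale beta_gamma: pair_prob_space \<eta> \<nu> ..

sublocale joint: pair_prob_space \<mu> "\<eta> \<Otimes>\<^sub>M \<nu>" ..

abbreviation M :: "('x \<times> 'y \<times> 'z) measure" where
  "M \<equiv> \<mu> \<Otimes>\<^sub>M (\<eta> \<Otimes>\<^sub>M \<nu>)"

text \<open>Fubini's theorem; the bound 1 makes integrability automatic on a probability
  space.\<close>

lemma integral_iterated:
  fixes F :: "'x \<times> 'y \<times> 'z \<Rightarrow> real"
  assumes [measurable]: "F \<in> borel_measurable M" and bound: "\<And>\<omega>. \<bar>F \<omega>\<bar> \<le> 1"
  shows "integral\<^sup>L M F = (\<integral>\<alpha>. \<integral>\<beta>. \<integral>\<gamma>. F (\<alpha>, \<beta>, \<gamma>) \<partial>\<nu> \<partial>\<eta> \<partial>\<mu>)"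
proof -
  have "integrable M F"
    by (rule joint.P.integrable_const_bound[where B = 1]) (use bound in auto)
  then have "integral\<^sup>L M F = (\<integral>\<alpha>. \<integral>y. F (\<alpha>, y) \<partial>(\<eta> \<Otimes>\<^sub>M \<nu>) \<partial>\<mu>)"
    by (rule joint.integral_fst'[symmetric])
  also have "\<dots> = (\<integral>\<alpha>. \<integral>\<beta>. \<integral>\<gamma>. F (\<alpha>, \<beta>, \<gamma>) \<partial>\<nu> \<partial>\<eta> \<partial>\<mu>)"
  proof (rule Bochner_Integration.integral_cong[OF refl])
    fix \<alpha> assume [measurable]: "\<alpha> \<in> space \<mu>"
    have "integrable (\<eta> \<Otimes>\<^sub>M \<nu>) (\<lambda>y. F (\<alpha>, y))"
      by (rule beta_gamma.P.integrable_const_bound[where B = 1]) (use bound in auto)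
    then show "(\<integral>y. F (\<alpha>, y) \<partial>(\<eta> \<Otimes>\<^sub>M \<nu>)) = (\<integral>\<beta>. \<integral>\<gamma>. F (\<alpha>, \<beta>, \<gamma>) \<partial>\<nu> \<partial>\<eta>)"
      by (rule beta_gamma.integral_fst'[symmetric])
  qed
  finally show ?thesis .
qed

text \<open>This is the form in which independence is used: the first party does not see \<alpha>,
  so any function of its two sources is uncorrelated with any function of \<alpha>. The two lemmas
  that follow do the same for the other sources.\<close>

lemma integral_mult_alpha:
  fixes k :: "'y \<times> 'z \<Rightarrow> real" and h :: "'x \<Rightarrow> real"
  assumes [measurable]: "k \<in> borel_measurable (\<eta> \<Otimes>\<^sub>M \<nu>)" "h \<in> borel_measurable \<mu>"
    and bound: "\<And>y. \<bar>k y\<bar> \<le> 1" "\<And>x. \<bar>h x\<bar> \<le> 1"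
  shows "(\<integral>\<omega>. k (snd \<omega>) * h (fst \<omega>) \<partial>M) = (\<integral>\<omega>. k (snd \<omega>) \<partial>M) * (\<integral>\<alpha>. h \<alpha> \<partial>\<mu>)"
  by (subst (1 2) integral_iterated) (use bound in \<open>auto simp: abs_mult_le_1 alpha.prob_space mult.commute\<close>)

lemma integral_mult_beta:
  fixes k :: "'z \<times> 'x \<Rightarrow> real" and f :: "'y \<Rightarrow> real"
  assumes [measurable]: "k \<in> borel_measurable (\<nu> \<Otimes>\<^sub>M \<mu>)" "f \<in> borel_measurable \<eta>"
    and bound: "\<And>y. \<bar>k y\<bar> \<le> 1" "\<And>x. \<bar>f x\<bar> \<le> 1"
  shows "(\<integral>\<omega>. k (snd (snd \<omega>), fst \<omega>) * f (fst (snd \<omega>)) \<partial>M) =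
    (\<integral>\<omega>. k (snd (snd \<omega>), fst \<omega>) \<partial>M) * (\<integral>\<beta>. f \<beta> \<partial>\<eta>)"
  by (subst (1 2) integral_iterated) (use bound in \<open>auto simp: abs_mult_le_1 beta.prob_space\<close>)

lemma integral_mult_gamma:
  fixes k :: "'x \<times> 'y \<Rightarrow> real" and g :: "'z \<Rightarrow> real"
  assumes [measurable]: "k \<in> borel_measurable (\<mu> \<Otimes>\<^sub>M \<eta>)" "g \<in> borel_measurable \<nu>"
    and bound: "\<And>y. \<bar>k y\<bar> \<le> 1" "\<And>x. \<bar>g x\<bar> \<le> 1"
  shows "(\<integral>\<omega>. k (fst \<omega>, fst (snd \<omega>)) * g (snd (snd \<omega>)) \<partial>M) =
    (\<integral>\<omega>. k (fst \<omega>, fst (snd \<omega>)) \<partial>M) * (\<integral>\<gamma>. g \<gamma> \<partial>\<nu>)"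
  by (subst (1 2) integral_iterated) (use bound in \<open>auto simp: abs_mult_le_1 gamma.prob_space\<close>)

text \<open>Freezing \<alpha> at a typical value splits \<open>a\<close> into a sign of \<beta>
  times a sign of \<gamma>. Inserting this into the product relation gives
  \<open>b * g = c * f\<close>; the left side does not involve \<beta> and the right side does not
  involve \<gamma>, so both depend on \<alpha> alone.\<close>

lemma parity_rigidity:
  fixes a :: "'y \<times> 'z \<Rightarrow> real" and b :: "'z \<times> 'x \<Rightarrow> real" and c :: "'x \<times> 'y \<Rightarrow> real"
  assumes meas [measurable]: "a \<in> borel_measurable (\<eta> \<Otimes>\<^sub>M \<nu>)"
      "b \<in> borel_measurable (\<nu> \<Otimes>\<^sub>M \<mu>)" "c \<in> borel_measurable (\<mu> \<Otimes>\<^sub>M \<eta>)"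
    and signs: "\<And>y. a y \<in> {-1, 1}" "\<And>y. b y \<in> {-1, 1}" "\<And>y. c y \<in> {-1, 1}"
    and ae: "AE \<omega> in M. a (snd \<omega>) * b (snd (snd \<omega>), fst \<omega>) * c (fst \<omega>, fst (snd \<omega>)) = 1"
  obtains f g h where "f \<in> borel_measurable \<eta>" "g \<in> borel_measurable \<nu>" "h \<in> borel_measurable \<mu>"
    "\<And>y. f y \<in> {-1, 1 :: real}" "\<And>z. g z \<in> {-1, 1 :: real}" "\<And>x. h x \<in> {-1, 1 :: real}"
    "AE \<omega> in M. a (snd \<omega>) = f (fst (snd \<omega>)) * g (snd (snd \<omega>)) \<and>
      b (snd (snd \<omega>), fst \<omega>) = g (snd (snd \<omega>)) * h (fst \<omega>) \<and>
      c (fst \<omega>, fst (snd \<omega>)) = h (fst \<omega>) * f (fst (snd \<omega>))"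
proof -
  have ae1: "AE \<alpha> in \<mu>. AE y in \<eta> \<Otimes>\<^sub>M \<nu>. a y * b (snd y, \<alpha>) * c (\<alpha>, fst y) = 1"
    using joint.AE_pair[OF ae] by simp
  \<comment> \<open>An almost sure property of a probability space holds somewhere. Membership in
    the space is retained because it makes the sections of \<open>b\<close> and \<open>c\<close> at
    that point measurable.\<close>
  have "\<exists>\<alpha>. \<alpha> \<in> space \<mu> \<and> (AE y in \<eta> \<Otimes>\<^sub>M \<nu>. a y * b (snd y, \<alpha>) * c (\<alpha>, fst y) = 1)"
    by (rule eventually_happens'[OF alpha.ae_filter_bot]) (use ae1 AE_space in \<open>rule eventually_conj[rotated]\<close>)
  then obtain \<alpha>0 where \<alpha>0 [measurable]: "\<alpha>0 \<in> space \<mu>"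
    and ae2: "AE y in \<eta> \<Otimes>\<^sub>M \<nu>. a y * b (snd y, \<alpha>0) * c (\<alpha>0, fst y) = 1" by blast
  define f where "f = (\<lambda>\<beta>. c (\<alpha>0, \<beta>))"
  define g where "g = (\<lambda>\<gamma>. b (\<gamma>, \<alpha>0))"
  \<comment> \<open>Taking the sign of a mean over \<gamma> gives a function that is measurable and
    has values in {-1, 1} everywhere, even on the null set of exceptional \<alpha>.\<close>
  define h where "h = (\<lambda>\<alpha>. if (\<integral>\<gamma>. b (\<gamma>, \<alpha>) * g \<gamma> \<partial>\<nu>) > 0 then 1 else - 1 :: real)"
  have f [measurable]: "f \<in> borel_measurable \<eta>" and g [measurable]: "g \<in> borel_measurable \<nu>"
    unfolding f_def g_def by measurable
  have h [measurable]: "h \<in> borel_measurable \<mu>"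
    unfolding h_def by measurable
  have fgh: "f y \<in> {-1, 1}" "g z \<in> {-1, 1}" "h x \<in> {-1, 1}" for x y z
    using signs by (auto simp: f_def g_def h_def)
  have "AE y in \<eta> \<Otimes>\<^sub>M \<nu>. a y = f (fst y) * g (snd y)"
    using ae2
  proof eventually_elim
    case (elim y)
    then show ?case using fgh(1)[of "fst y"] fgh(2)[of "snd y"] signs(1)[of y]
      by (auto simp: f_def g_def)
  qed
  then have a_eq: "AE \<omega> in M. a (snd \<omega>) = f (fst (snd \<omega>)) * g (snd (snd \<omega>))"
    by (intro joint.AE_pair_measure) auto
  have bc: "AE \<omega> in M. b (snd (snd \<omega>), fst \<omega>) * g (snd (snd \<omega>)) = c (fst \<omega>, fst (snd \<omega>)) * f (fst (snd \<omega>))"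
    using a_eq ae
  proof eventually_elim
    case (elim \<omega>)
    then show ?case
      using fgh(1)[of "fst (snd \<omega>)"] fgh(2)[of "snd (snd \<omega>)"] signs(2)[of "(snd (snd \<omega>), fst \<omega>)"]
        signs(3)[of "(fst \<omega>, fst (snd \<omega>))"] by auto
  qed
  have "AE \<alpha> in \<mu>. AE y in \<eta> \<Otimes>\<^sub>M \<nu>. c (\<alpha>, fst y) * f (fst y) = h \<alpha>"
    using joint.AE_pair[OF bc] AE_space
  proof eventually_elim
    case (elim \<alpha>)
    note [measurable] = elim(2)
    have "AE \<beta> in \<eta>. AE \<gamma> in \<nu>. b (\<gamma>, \<alpha>) * g \<gamma> = c (\<alpha>, \<beta>) * f \<beta>"
      using beta_gamma.AE_pair[of "\<lambda>y. b (snd y, \<alpha>) * g (snd y) = c (\<alpha>, fst y) * f (fst y)"] elim(1) by simp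
    then have "AE \<beta> in \<eta>. c (\<alpha>, \<beta>) * f \<beta> = h \<alpha>"
    proof eventually_elim
      case (elim \<beta>)
      \<comment> \<open>For fixed \<alpha> and \<beta> the right side is constant in \<gamma>, so
        the mean is itself a sign and agrees with \<open>h \<alpha>\<close>.\<close>
      have "(\<integral>\<gamma>. b (\<gamma>, \<alpha>) * g \<gamma> \<partial>\<nu>) = (\<integral>\<gamma>. c (\<alpha>, \<beta>) * f \<beta> \<partial>\<nu>)"
        by (rule integral_cong_AE) (use elim in auto)
      also have "\<dots> = c (\<alpha>, \<beta>) * f \<beta>" by (simp add: gamma.prob_space)
      finally show ?case using signs(3)[of "(\<alpha>, \<beta>)"] fgh(1)[of \<beta>] by (auto simp: h_def)
    qed
    then show ?case by (intro beta_gamma.AE_pair_measure) auto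
  qed
  then have c_eq: "AE \<omega> in M. c (fst \<omega>, fst (snd \<omega>)) * f (fst (snd \<omega>)) = h (fst \<omega>)"
    by (intro joint.AE_pair_measure) auto
  have "AE \<omega> in M. a (snd \<omega>) = f (fst (snd \<omega>)) * g (snd (snd \<omega>)) \<and>
      b (snd (snd \<omega>), fst \<omega>) = g (snd (snd \<omega>)) * h (fst \<omega>) \<and>
      c (fst \<omega>, fst (snd \<omega>)) = h (fst \<omega>) * f (fst (snd \<omega>))"
    using a_eq bc c_eq
  proof eventually_elim
    case (elim \<omega>)
    show ?case
      using elim(1,2) elim(3)[symmetric] fgh(1)[of "fst (snd \<omega>)"] fgh(2)[of "snd (snd \<omega>)"] signs(2)[of "(snd (snd \<omega>), fst \<omega>)"]
        signs(3)[of "(fst \<omega>, fst (snd \<omega>))"] by auto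
  qed
  with that[OF f g h fgh] show thesis by blast
qed

text \<open>By independence the means of \<open>f\<close>, \<open>g\<close>, \<open>h\<close> have
  pairwise products \<open>q\<^sup>2\<close>, hence are all \<open>q\<close> or all
  \<open>- q\<close>. Flipping the three signs together preserves their pairwise products and
  settles the choice.\<close>

lemma parity_rigidity_biased:
  fixes a :: "'y \<times> 'z \<Rightarrow> real" and b :: "'z \<times> 'x \<Rightarrow> real" and c :: "'x \<times> 'y \<Rightarrow> real"
  assumes meas [measurable]: "a \<in> borel_measurable (\<eta> \<Otimes>\<^sub>M \<nu>)"
      "b \<in> borel_measurable (\<nu> \<Otimes>\<^sub>M \<mu>)" "c \<in> borel_measurable (\<mu> \<Otimes>\<^sub>M \<eta>)"
    and signs: "\<And>y. a y \<in> {-1, 1}" "\<And>y. b y \<in> {-1, 1}" "\<And>y. c y \<in> {-1, 1}"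
    and ae: "AE \<omega> in M. a (snd \<omega>) * b (snd (snd \<omega>), fst \<omega>) * c (fst \<omega>, fst (snd \<omega>)) = 1"
    and mean: "(\<integral>\<omega>. a (snd \<omega>) \<partial>M) = q\<^sup>2" "(\<integral>\<omega>. b (snd (snd \<omega>), fst \<omega>) \<partial>M) = q\<^sup>2"
      "(\<integral>\<omega>. c (fst \<omega>, fst (snd \<omega>)) \<partial>M) = q\<^sup>2" and q: "q > 0"
  obtains f g h where "f \<in> borel_measurable \<eta>" "g \<in> borel_measurable \<nu>" "h \<in> borel_measurable \<mu>"
    "\<And>y. f y \<in> {-1, 1 :: real}" "\<And>z. g z \<in> {-1, 1 :: real}" "\<And>x. h x \<in> {-1, 1 :: real}"
    "integral\<^sup>L \<eta> f = q" "integral\<^sup>L \<nu> g = q" "integral\<^sup>L \<mu> h = q"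
    "AE \<omega> in M. a (snd \<omega>) = f (fst (snd \<omega>)) * g (snd (snd \<omega>)) \<and>
      b (snd (snd \<omega>), fst \<omega>) = g (snd (snd \<omega>)) * h (fst \<omega>) \<and>
      c (fst \<omega>, fst (snd \<omega>)) = h (fst \<omega>) * f (fst (snd \<omega>))"
proof -
  obtain f g h where [measurable]: "f \<in> borel_measurable \<eta>" "g \<in> borel_measurable \<nu>" "h \<in> borel_measurable \<mu>"
    and fgh: "\<And>y. f y \<in> {-1, 1 :: real}" "\<And>z. g z \<in> {-1, 1 :: real}" "\<And>x. h x \<in> {-1, 1 :: real}"
    and eq: "AE \<omega> in M. a (snd \<omega>) = f (fst (snd \<omega>)) * g (snd (snd \<omega>)) \<and>
      b (snd (snd \<omega>), fst \<omega>) = g (snd (snd \<omega>)) * h (fst \<omega>) \<and>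
      c (fst \<omega>, fst (snd \<omega>)) = h (fst \<omega>) * f (fst (snd \<omega>))"
    using parity_rigidity[OF meas signs ae] by blast
  have bound: "\<bar>f y\<bar> \<le> 1" "\<bar>g z\<bar> \<le> 1" "\<bar>h x\<bar> \<le> 1" for x y z
    using fgh(1)[of y] fgh(2)[of z] fgh(3)[of x] by auto
  have f1: "(\<integral>\<omega>. f (fst (snd \<omega>)) \<partial>M) = integral\<^sup>L \<eta> f"
    using integral_mult_beta[of "\<lambda>_. 1" f] bound by (simp add: joint.P.prob_space)
  have g1: "(\<integral>\<omega>. g (snd (snd \<omega>)) \<partial>M) = integral\<^sup>L \<nu> g"
    using integral_mult_gamma[of "\<lambda>_. 1" g] bound by (simp add: joint.P.prob_space)
  have "q\<^sup>2 = (\<integral>\<omega>. f (fst (snd \<omega>)) * g (snd (snd \<omega>)) \<partial>M)"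
    unfolding mean(1)[symmetric] by (rule integral_cong_AE) (use eq in auto)
  also have "\<dots> = integral\<^sup>L \<eta> f * integral\<^sup>L \<nu> g"
    using integral_mult_gamma[of "\<lambda>y. f (snd y)" g] bound by (simp add: f1)
  finally have 1: "integral\<^sup>L \<eta> f * integral\<^sup>L \<nu> g = q\<^sup>2" ..
  have "q\<^sup>2 = (\<integral>\<omega>. g (snd (snd \<omega>)) * h (fst \<omega>) \<partial>M)"
    unfolding mean(2)[symmetric] by (rule integral_cong_AE) (use eq in auto)
  also have "\<dots> = integral\<^sup>L \<nu> g * integral\<^sup>L \<mu> h"
    using integral_mult_alpha[of "\<lambda>y. g (snd y)" h] bound by (simp add: g1)
  finally have 2: "integral\<^sup>L \<nu> g * integral\<^sup>L \<mu> h = q\<^sup>2" ..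
  have "q\<^sup>2 = (\<integral>\<omega>. f (fst (snd \<omega>)) * h (fst \<omega>) \<partial>M)"
    unfolding mean(3)[symmetric] by (rule integral_cong_AE) (use eq in auto)
  also have "\<dots> = integral\<^sup>L \<eta> f * integral\<^sup>L \<mu> h"
    using integral_mult_alpha[of "\<lambda>y. f (fst y)" h] bound by (simp add: f1)
  finally have 3: "integral\<^sup>L \<eta> f * integral\<^sup>L \<mu> h = q\<^sup>2" ..
  \<comment> \<open>Any two of the three products share a factor, which is nonzero because
    \<open>q > 0\<close> and can be cancelled.\<close>
  have fg: "integral\<^sup>L \<eta> f = integral\<^sup>L \<nu> g" and gh: "integral\<^sup>L \<mu> h = integral\<^sup>L \<nu> g"
    using 1 2 3 q by (metis mult.commute mult_cancel_left mult_zero_left power_not_zero less_irrefl)+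
  have "(integral\<^sup>L \<nu> g)\<^sup>2 = q\<^sup>2" using 1 fg by (simp add: power2_eq_square)
  then consider "integral\<^sup>L \<nu> g = q" | "integral\<^sup>L \<nu> g = - q"
    by (auto simp: power2_eq_iff)
  then show thesis
  proof cases
    case 1
    with that[of f g h] fgh fg gh eq show thesis by simp
  next
    case 2
    have "- f y \<in> {-1, 1}" "- g z \<in> {-1, 1}" "- h x \<in> {-1, 1}" for x y z
      using fgh(1)[of y] fgh(2)[of z] fgh(3)[of x] by auto
    with 2 fg gh eq show thesis
      by (intro that[of "\<lambda>x. - f x" "\<lambda>x. - g x" "\<lambda>x. - h x"]) simp_all
  qed
qed

end

text \<open>In the application \<open>A\<^sub>0\<close> is the probability of \<open>Bar1_0\<close>,
  whereas \<open>A\<close>, \<open>B\<close>, \<open>C\<close> are those of \<open>Bar0\<close>, and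
  1/3 is the mean of \<open>h\<close>. With m and n the expectations of \<open>A\<^sub>0\<close> and
  \<open>A\<^sub>0 * g\<close>, the two expectations on the right are (m - n/3)/2 and (m + n/3)/2,
  while the left side is (m - n)/6. So m and n can be eliminated.\<close>

lemma (in prob_space) restricted_marginal:
  fixes A\<^sub>0 A B C f g h :: "'a \<Rightarrow> real"
  assumes meas [measurable]: "random_variable borel A\<^sub>0" "random_variable borel B" "random_variable borel C"
      "random_variable borel f" "random_variable borel g" "random_variable borel h"
    and signs: "\<And>x. f x \<in> {-1, 1}" "\<And>x. g x \<in> {-1, 1}" "\<And>x. h x \<in> {-1, 1}"
    and A\<^sub>0: "\<And>x. 0 \<le> A\<^sub>0 x" "\<And>x. A\<^sub>0 x + A x \<le> 1"
    and A: "\<And>x. 0 \<le> A x"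
    and ae: "AE x in M. A x = (1 - f x * g x) / 2" "AE x in M. B x = (1 - g x * h x) / 2"
      "AE x in M. C x = (1 - h x * f x) / 2"
    and indep: "expectation (\<lambda>x. A\<^sub>0 x * h x) = expectation A\<^sub>0 / 3"
      "expectation (\<lambda>x. A\<^sub>0 x * g x * h x) = expectation (\<lambda>x. A\<^sub>0 x * g x) / 3"
  shows "expectation (\<lambda>x. A\<^sub>0 x * ((1 - f x) * (1 - g x) * (1 - h x) / 8)) =
    (2 * expectation (\<lambda>x. A\<^sub>0 x * B x * C x) - expectation (\<lambda>x. A\<^sub>0 x * (1 - B x) * (1 - C x))) / 3"
proof -
  have A1: "A\<^sub>0 x \<le> 1" for x using A\<^sub>0(2)[of x] A[of x] by linarith
  have int [simp]: "integrable M A\<^sub>0" "integrable M (\<lambda>x. A\<^sub>0 x * g x)" "integrable M (\<lambda>x. A\<^sub>0 x * h x)"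
     "integrable M (\<lambda>x. A\<^sub>0 x * g x * h x)"
  proof -
    have "\<bar>A\<^sub>0 x * g x\<bar> \<le> 1" "\<bar>A\<^sub>0 x * h x\<bar> \<le> 1" "\<bar>A\<^sub>0 x * g x * h x\<bar> \<le> 1" "\<bar>A\<^sub>0 x\<bar> \<le> 1" for x
      using A1[of x] A\<^sub>0(1)[of x] signs(2)[of x] signs(3)[of x] by auto
    then show "integrable M A\<^sub>0" "integrable M (\<lambda>x. A\<^sub>0 x * g x)" "integrable M (\<lambda>x. A\<^sub>0 x * h x)"
     "integrable M (\<lambda>x. A\<^sub>0 x * g x * h x)"
      by (auto intro!: integrable_const_bound[where B = 1])
  qed
  \<comment> \<open>Where \<open>f\<close> and \<open>g\<close> differ, \<open>A\<close> equals 1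
    and leaves no room for \<open>A\<^sub>0\<close>.\<close>
  have support: "AE x in M. A\<^sub>0 x = 0 \<or> f x = g x"
    using ae(1)
  proof eventually_elim
    case (elim x)
    then show ?case using signs(1)[of x] signs(2)[of x] A\<^sub>0[of x] by auto
  qed
  \<comment> \<open>On the support \<open>f = g\<close>, so \<open>B\<close> and \<open>C\<close>
    are the same 0-1 function \<open>(1 - g * h) / 2\<close> and their product is again that
    function.\<close>
  have "expectation (\<lambda>x. A\<^sub>0 x * B x * C x) = expectation (\<lambda>x. (A\<^sub>0 x - A\<^sub>0 x * g x * h x) / 2)"
  proof (rule integral_cong_AE)
    show "AE x in M. A\<^sub>0 x * B x * C x = (A\<^sub>0 x - A\<^sub>0 x * g x * h x) / 2"
      using ae(2,3) support
    proof eventually_elim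
      case (elim x)
      then show ?case using signs(2)[of x] signs(3)[of x] by auto
    qed
  qed auto
  then have 1: "expectation (\<lambda>x. A\<^sub>0 x * B x * C x) = (expectation A\<^sub>0 - expectation (\<lambda>x. A\<^sub>0 x * g x) / 3) / 2"
    by (simp add: indep)
  have "expectation (\<lambda>x. A\<^sub>0 x * (1 - B x) * (1 - C x)) = expectation (\<lambda>x. (A\<^sub>0 x + A\<^sub>0 x * g x * h x) / 2)"
  proof (rule integral_cong_AE)
    show "AE x in M. A\<^sub>0 x * (1 - B x) * (1 - C x) = (A\<^sub>0 x + A\<^sub>0 x * g x * h x) / 2"
      using ae(2,3) support
    proof eventually_elim
      case (elim x)
      then show ?case using signs(2)[of x] signs(3)[of x] by auto
    qed
  qed auto
  then have 2: "expectation (\<lambda>x. A\<^sub>0 x * (1 - B x) * (1 - C x)) = (expectation A\<^sub>0 + expectation (\<lambda>x. A\<^sub>0 x * g x) / 3) / 2"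
    by (simp add: indep)
  \<comment> \<open>Here \<open>f = g\<close> reduces the square of \<open>1 - g\<close> to
    \<open>2 * (1 - g)\<close>, as \<open>g\<close> is a sign.\<close>
  have "expectation (\<lambda>x. A\<^sub>0 x * ((1 - f x) * (1 - g x) * (1 - h x) / 8)) =
    expectation (\<lambda>x. (A\<^sub>0 x - A\<^sub>0 x * g x - A\<^sub>0 x * h x + A\<^sub>0 x * g x * h x) / 4)"
  proof (rule integral_cong_AE)
    show "AE x in M. A\<^sub>0 x * ((1 - f x) * (1 - g x) * (1 - h x) / 8) =
      (A\<^sub>0 x - A\<^sub>0 x * g x - A\<^sub>0 x * h x + A\<^sub>0 x * g x * h x) / 4"
      using support
    proof eventually_elim
      case (elim x)
      then show ?case using signs(2)[of x] signs(3)[of x] by auto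
    qed
  qed auto
  also have "\<dots> = (expectation A\<^sub>0 - expectation (\<lambda>x. A\<^sub>0 x * g x) - expectation A\<^sub>0 / 3
      + expectation (\<lambda>x. A\<^sub>0 x * g x) / 3) / 4"
    by (simp add: indep)
  finally show ?thesis unfolding 1 2 by (simp add: field_simps)
qed

section \<open>Three-outcome response functions on the triangle\<close>

locale triangle_model = three_sources \<mu> \<eta> \<nu>
  for \<mu> :: "'x measure" and \<eta> :: "'y measure" and \<nu> :: "'z measure" +
  fixes X :: "outcome \<Rightarrow> 'y \<times> 'z \<Rightarrow> real"
    and Y :: "outcome \<Rightarrow> 'z \<times> 'x \<Rightarrow> real"
    and Z :: "outcome \<Rightarrow> 'x \<times> 'y \<Rightarrow> real"
    and P :: "outcome \<Rightarrow> outcome \<Rightarrow> outcome \<Rightarrow> real"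
  assumes meas [measurable]: "\<And>i. X i \<in> borel_measurable (\<eta> \<Otimes>\<^sub>M \<nu>)"
      "\<And>i. Y i \<in> borel_measurable (\<nu> \<Otimes>\<^sub>M \<mu>)" "\<And>i. Z i \<in> borel_measurable (\<mu> \<Otimes>\<^sub>M \<eta>)"
    and nonneg: "\<And>i y. 0 \<le> X i y" "\<And>i y. 0 \<le> Y i y" "\<And>i y. 0 \<le> Z i y"
    and total: "\<And>y. X Bar0 y + X Bar1_0 y + X Bar1_1 y = 1" "\<And>y. Y Bar0 y + Y Bar1_0 y + Y Bar1_1 y = 1"
      "\<And>y. Z Bar0 y + Z Bar1_0 y + Z Bar1_1 y = 1"
    and P_eq: "\<And>i j k. P i j k =
      (\<integral>\<omega>. X i (snd \<omega>) * Y j (snd (snd \<omega>), fst \<omega>) * Z k (fst \<omega>, fst (snd \<omega>)) \<partial>M)"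
begin

text \<open>The response functions are lifted to the joint source space, so that almost sure
  statements about different parties can be combined.\<close>

definition A where "A i \<omega> = X i (snd \<omega>)"
definition B where "B i \<omega> = Y i (snd (snd \<omega>), fst \<omega>)"
definition C where "C i \<omega> = Z i (fst \<omega>, fst (snd \<omega>))"

lemma ABC_meas [measurable]: "A i \<in> borel_measurable M" "B i \<in> borel_measurable M" "C i \<in> borel_measurable M"
  unfolding A_def B_def C_def by measurable

lemma ABC_nonneg: "0 \<le> A i \<omega>" "0 \<le> B i \<omega>" "0 \<le> C i \<omega>"
  by (auto simp: A_def B_def C_def nonneg)

lemma ABC_total: "1 - A Bar0 \<omega> = A Bar1_0 \<omega> + A Bar1_1 \<omega>" "1 - B Bar0 \<omega> = B Bar1_0 \<omega> + B Bar1_1 \<omega>"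
   "1 - C Bar0 \<omega> = C Bar1_0 \<omega> + C Bar1_1 \<omega>"
  using total(1)[of "snd \<omega>"] total(2)[of "(snd (snd \<omega>), fst \<omega>)"] total(3)[of "(fst \<omega>, fst (snd \<omega>))"]
  by (auto simp: A_def B_def C_def)

lemma X_le_1: "X i y \<le> 1" and Y_le_1: "Y i y' \<le> 1" and Z_le_1: "Z i y'' \<le> 1"
  using total(1)[of y] total(2)[of y'] total(3)[of y''] nonneg(1)[of _ y] nonneg(2)[of _ y'] nonneg(3)[of _ y'']
  by (cases i; smt (verit))+

lemma ABC_le_1: "A i \<omega> \<le> 1" "B i \<omega> \<le> 1" "C i \<omega> \<le> 1"
  by (auto simp: A_def B_def C_def X_le_1 Y_le_1 Z_le_1)

lemma P_integral: "P i j k = (\<integral>\<omega>. A i \<omega> * B j \<omega> * C k \<omega> \<partial>M)"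
  by (simp add: P_eq A_def B_def C_def)

lemma ABC_integrable [simp]: "integrable M (\<lambda>\<omega>. A i \<omega> * B j \<omega> * C k \<omega>)"
proof -
  have "\<bar>A i \<omega> * B j \<omega> * C k \<omega>\<bar> \<le> 1" for \<omega>
    using ABC_nonneg ABC_le_1 by (intro abs_mult_le_1) auto
  then show ?thesis by (intro joint.P.integrable_const_bound[where B = 1]) auto
qed

text \<open>A nonnegative integrand with zero integral vanishes almost everywhere.\<close>

lemma AE_P_zero: "P i j k = 0 \<Longrightarrow> AE \<omega> in M. A i \<omega> * B j \<omega> * C k \<omega> = 0"
  using integral_nonneg_eq_0_iff_AE[of M "\<lambda>\<omega>. A i \<omega> * B j \<omega> * C k \<omega>"]
  by (simp add: P_integral ABC_nonneg)

text \<open>For fixed sources the outputs of each other party have total probability 1, so summing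
  them out leaves the marginal. The same holds for the other two parties below.\<close>

lemma integral_A: "integral\<^sup>L M (A i) = (\<Sum>j\<in>{Bar0, Bar1_0, Bar1_1}. \<Sum>k\<in>{Bar0, Bar1_0, Bar1_1}. P i j k)"
proof -
  have "(\<Sum>j\<in>{Bar0, Bar1_0, Bar1_1}. \<Sum>k\<in>{Bar0, Bar1_0, Bar1_1}. P i j k) =
    (\<integral>\<omega>. (\<Sum>j\<in>{Bar0, Bar1_0, Bar1_1}. \<Sum>k\<in>{Bar0, Bar1_0, Bar1_1}. A i \<omega> * B j \<omega> * C k \<omega>) \<partial>M)"
    by (simp add: P_integral)
  also have "\<dots> = (\<integral>\<omega>. A i \<omega> * (\<Sum>j\<in>{Bar0, Bar1_0, Bar1_1}. B j \<omega>) * (\<Sum>k\<in>{Bar0, Bar1_0, Bar1_1}. C k \<omega>) \<partial>M)"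
    by (simp add: algebra_simps)
  also have "\<dots> = integral\<^sup>L M (A i)"
  proof -
    have "B Bar0 \<omega> + (B Bar1_0 \<omega> + B Bar1_1 \<omega>) = 1" "C Bar0 \<omega> + (C Bar1_0 \<omega> + C Bar1_1 \<omega>) = 1" for \<omega>
      using ABC_total[of \<omega>] by auto
    then show ?thesis by simp
  qed
  finally show ?thesis ..
qed

lemma integral_B: "integral\<^sup>L M (B j) = (\<Sum>i\<in>{Bar0, Bar1_0, Bar1_1}. \<Sum>k\<in>{Bar0, Bar1_0, Bar1_1}. P i j k)"
proof -
  have "(\<Sum>i\<in>{Bar0, Bar1_0, Bar1_1}. \<Sum>k\<in>{Bar0, Bar1_0, Bar1_1}. P i j k) =
    (\<integral>\<omega>. (\<Sum>i\<in>{Bar0, Bar1_0, Bar1_1}. \<Sum>k\<in>{Bar0, Bar1_0, Bar1_1}. A i \<omega> * B j \<omega> * C k \<omega>) \<partial>M)"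
    by (simp add: P_integral)
  also have "\<dots> = (\<integral>\<omega>. (\<Sum>i\<in>{Bar0, Bar1_0, Bar1_1}. A i \<omega>) * B j \<omega> * (\<Sum>k\<in>{Bar0, Bar1_0, Bar1_1}. C k \<omega>) \<partial>M)"
    by (simp add: algebra_simps)
  also have "\<dots> = integral\<^sup>L M (B j)"
  proof -
    have "A Bar0 \<omega> + (A Bar1_0 \<omega> + A Bar1_1 \<omega>) = 1" "C Bar0 \<omega> + (C Bar1_0 \<omega> + C Bar1_1 \<omega>) = 1" for \<omega>
      using ABC_total[of \<omega>] by auto
    then show ?thesis by simp
  qed
  finally show ?thesis ..
qed

lemma integral_C: "integral\<^sup>L M (C k) = (\<Sum>i\<in>{Bar0, Bar1_0, Bar1_1}. \<Sum>j\<in>{Bar0, Bar1_0, Bar1_1}. P i j k)"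
proof -
  have "(\<Sum>i\<in>{Bar0, Bar1_0, Bar1_1}. \<Sum>j\<in>{Bar0, Bar1_0, Bar1_1}. P i j k) =
    (\<integral>\<omega>. (\<Sum>i\<in>{Bar0, Bar1_0, Bar1_1}. \<Sum>j\<in>{Bar0, Bar1_0, Bar1_1}. A i \<omega> * B j \<omega> * C k \<omega>) \<partial>M)"
    by (simp add: P_integral)
  also have "\<dots> = (\<integral>\<omega>. (\<Sum>i\<in>{Bar0, Bar1_0, Bar1_1}. A i \<omega>) * (\<Sum>j\<in>{Bar0, Bar1_0, Bar1_1}. B j \<omega>) * C k \<omega> \<partial>M)"
    by (simp add: algebra_simps)
  also have "\<dots> = integral\<^sup>L M (C k)"
  proof -
    have "A Bar0 \<omega> + (A Bar1_0 \<omega> + A Bar1_1 \<omega>) = 1" "B Bar0 \<omega> + (B Bar1_0 \<omega> + B Bar1_1 \<omega>) = 1" for \<omega>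
      using ABC_total[of \<omega>] by auto
    then show ?thesis by simp
  qed
  finally show ?thesis ..
qed

end

section \<open>Local models with an odd number of outputs of type bar 1\<close>

locale token_model = triangle_model \<mu> \<eta> \<nu> X Y Z P
  for \<mu> :: "'x measure" and \<eta> :: "'y measure" and \<nu> :: "'z measure" and X Y Z P +
  assumes zero: "P Bar0 Bar0 Bar0 = 0"
    "\<And>i j. i \<noteq> Bar0 \<Longrightarrow> j \<noteq> Bar0 \<Longrightarrow> P i j Bar0 = 0"
    "\<And>i j. i \<noteq> Bar0 \<Longrightarrow> j \<noteq> Bar0 \<Longrightarrow> P i Bar0 j = 0"
    "\<And>i j. i \<noteq> Bar0 \<Longrightarrow> j \<noteq> Bar0 \<Longrightarrow> P Bar0 i j = 0"
    and single: "P Bar1_0 Bar0 Bar0 + P Bar1_1 Bar0 Bar0 = 2/9"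
      "P Bar0 Bar1_0 Bar0 + P Bar0 Bar1_1 Bar0 = 2/9"
      "P Bar0 Bar0 Bar1_0 + P Bar0 Bar0 Bar1_1 = 2/9"
begin

text \<open>Given the sources the outputs are independent, so an impossible combination makes the
  product of the three response probabilities vanish almost surely. Adding up the variants of bar 1
  gives the hypotheses of \<open>deterministic_of_odd_parity\<close>.\<close>

lemma AE_deterministic:
  "AE \<omega> in M. A Bar0 \<omega> \<in> {0, 1} \<and> B Bar0 \<omega> \<in> {0, 1} \<and> C Bar0 \<omega> \<in> {0, 1} \<and>
    (1 - 2 * A Bar0 \<omega>) * (1 - 2 * B Bar0 \<omega>) * (1 - 2 * C Bar0 \<omega>) = 1"
proof -
  note z = AE_P_zero[OF zero(1)] AE_P_zero[OF zero(2)] AE_P_zero[OF zero(3)] AE_P_zero[OF zero(4)]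
  have "AE \<omega> in M. A Bar1_0 \<omega> * B Bar1_0 \<omega> * C Bar0 \<omega> = 0 \<and> A Bar1_0 \<omega> * B Bar1_1 \<omega> * C Bar0 \<omega> = 0 \<and>
      A Bar1_1 \<omega> * B Bar1_0 \<omega> * C Bar0 \<omega> = 0 \<and> A Bar1_1 \<omega> * B Bar1_1 \<omega> * C Bar0 \<omega> = 0"
    by (intro AE_conjI z) simp_all
  then have "AE \<omega> in M. (1 - A Bar0 \<omega>) * (1 - B Bar0 \<omega>) * C Bar0 \<omega> = 0"
    by eventually_elim (simp only: ABC_total distrib_left distrib_right add_0_right)
  moreover have "AE \<omega> in M. A Bar1_0 \<omega> * B Bar0 \<omega> * C Bar1_0 \<omega> = 0 \<and> A Bar1_0 \<omega> * B Bar0 \<omega> * C Bar1_1 \<omega> = 0 \<and>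
      A Bar1_1 \<omega> * B Bar0 \<omega> * C Bar1_0 \<omega> = 0 \<and> A Bar1_1 \<omega> * B Bar0 \<omega> * C Bar1_1 \<omega> = 0"
    by (intro AE_conjI z) simp_all
  then have "AE \<omega> in M. (1 - A Bar0 \<omega>) * B Bar0 \<omega> * (1 - C Bar0 \<omega>) = 0"
    by eventually_elim (simp only: ABC_total distrib_left distrib_right add_0_right)
  moreover have "AE \<omega> in M. A Bar0 \<omega> * B Bar1_0 \<omega> * C Bar1_0 \<omega> = 0 \<and> A Bar0 \<omega> * B Bar1_0 \<omega> * C Bar1_1 \<omega> = 0 \<and>
      A Bar0 \<omega> * B Bar1_1 \<omega> * C Bar1_0 \<omega> = 0 \<and> A Bar0 \<omega> * B Bar1_1 \<omega> * C Bar1_1 \<omega> = 0"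
    by (intro AE_conjI z) simp_all
  then have "AE \<omega> in M. A Bar0 \<omega> * (1 - B Bar0 \<omega>) * (1 - C Bar0 \<omega>) = 0"
    by eventually_elim (simp only: ABC_total distrib_left distrib_right add_0_right)
  ultimately show ?thesis
    using z(1) by eventually_elim (rule deterministic_of_odd_parity)
qed

text \<open>A party outputs \<open>Bar0\<close> exactly when one of the other two is the only one
  with output bar 1, which has probability 2/9 + 2/9.\<close>

lemma integral_Bar0: "integral\<^sup>L M (A Bar0) = 4/9" "integral\<^sup>L M (B Bar0) = 4/9" "integral\<^sup>L M (C Bar0) = 4/9"
  unfolding integral_A integral_B integral_C using single by (simp_all add: zero)

lemma parity_functions:
  obtains f g h where "f \<in> borel_measurable \<eta>" "g \<in> borel_measurable \<nu>" "h \<in> borel_measurable \<mu>"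
    "\<And>y. f y \<in> {-1, 1 :: real}" "\<And>z. g z \<in> {-1, 1 :: real}" "\<And>x. h x \<in> {-1, 1 :: real}"
    "integral\<^sup>L \<eta> f = 1/3" "integral\<^sup>L \<nu> g = 1/3" "integral\<^sup>L \<mu> h = 1/3"
    "AE \<omega> in M. A Bar0 \<omega> = (1 - f (fst (snd \<omega>)) * g (snd (snd \<omega>))) / 2"
    "AE \<omega> in M. B Bar0 \<omega> = (1 - g (snd (snd \<omega>)) * h (fst \<omega>)) / 2"
    "AE \<omega> in M. C Bar0 \<omega> = (1 - h (fst \<omega>) * f (fst (snd \<omega>))) / 2"
proof -
  \<comment> \<open>\<open>AE_deterministic\<close> holds only almost everywhere, so the responses
    are rounded at 1/2 to obtain functions that are signs at every point.\<close>
  define a where "a y = (if X Bar0 y < 1/2 then 1 else - 1 :: real)" for y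
  define b where "b y = (if Y Bar0 y < 1/2 then 1 else - 1 :: real)" for y
  define c where "c y = (if Z Bar0 y < 1/2 then 1 else - 1 :: real)" for y
  have meas' [measurable]: "a \<in> borel_measurable (\<eta> \<Otimes>\<^sub>M \<nu>)"
      "b \<in> borel_measurable (\<nu> \<Otimes>\<^sub>M \<mu>)" "c \<in> borel_measurable (\<mu> \<Otimes>\<^sub>M \<eta>)"
    unfolding a_def b_def c_def by measurable
  have signs: "a y \<in> {-1, 1}" "b y' \<in> {-1, 1}" "c y'' \<in> {-1, 1}" for y y' y''
    by (auto simp: a_def b_def c_def)
  have abc: "AE \<omega> in M. a (snd \<omega>) = 1 - 2 * A Bar0 \<omega> \<and> b (snd (snd \<omega>), fst \<omega>) = 1 - 2 * B Bar0 \<omega>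
      \<and> c (fst \<omega>, fst (snd \<omega>)) = 1 - 2 * C Bar0 \<omega>"
    using AE_deterministic
    by eventually_elim (auto simp: a_def b_def c_def A_def B_def C_def)
  have ae: "AE \<omega> in M. a (snd \<omega>) * b (snd (snd \<omega>), fst \<omega>) * c (fst \<omega>, fst (snd \<omega>)) = 1"
    using abc AE_deterministic by eventually_elim simp
  have [simp]: "integrable M (A i)" "integrable M (B i)" "integrable M (C i)" for i
    using ABC_nonneg ABC_le_1 by (auto intro!: joint.P.integrable_const_bound[where B = 1])
  \<comment> \<open>The mean is 1 - 2 * 4/9 = 1/9, so \<open>parity_rigidity_biased\<close> applies
    with \<open>q = 1/3\<close>.\<close>
  have "(\<integral>\<omega>. a (snd \<omega>) \<partial>M) = (\<integral>\<omega>. 1 - 2 * A Bar0 \<omega> \<partial>M)"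
    by (rule integral_cong_AE) (use abc in auto)
  then have 1: "(\<integral>\<omega>. a (snd \<omega>) \<partial>M) = (1/3)\<^sup>2"
    by (simp add: integral_Bar0 joint.P.prob_space power2_eq_square)
  have "(\<integral>\<omega>. b (snd (snd \<omega>), fst \<omega>) \<partial>M) = (\<integral>\<omega>. 1 - 2 * B Bar0 \<omega> \<partial>M)"
    by (rule integral_cong_AE) (use abc in auto)
  then have 2: "(\<integral>\<omega>. b (snd (snd \<omega>), fst \<omega>) \<partial>M) = (1/3)\<^sup>2"
    by (simp add: integral_Bar0 joint.P.prob_space power2_eq_square)
  have "(\<integral>\<omega>. c (fst \<omega>, fst (snd \<omega>)) \<partial>M) = (\<integral>\<omega>. 1 - 2 * C Bar0 \<omega> \<partial>M)"
    by (rule integral_cong_AE) (use abc in auto)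
  then have 3: "(\<integral>\<omega>. c (fst \<omega>, fst (snd \<omega>)) \<partial>M) = (1/3)\<^sup>2"
    by (simp add: integral_Bar0 joint.P.prob_space power2_eq_square)
  show thesis
  proof (rule parity_rigidity_biased[OF meas' signs ae 1 2 3])
    fix f g h
    assume fgh: "f \<in> borel_measurable \<eta>" "g \<in> borel_measurable \<nu>" "h \<in> borel_measurable \<mu>"
      "\<And>y. f y \<in> {-1, 1 :: real}" "\<And>z. g z \<in> {-1, 1 :: real}" "\<And>x. h x \<in> {-1, 1 :: real}"
      "integral\<^sup>L \<eta> f = 1/3" "integral\<^sup>L \<nu> g = 1/3" "integral\<^sup>L \<mu> h = 1/3"
    assume eq: "AE \<omega> in M. a (snd \<omega>) = f (fst (snd \<omega>)) * g (snd (snd \<omega>)) \<and>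
      b (snd (snd \<omega>), fst \<omega>) = g (snd (snd \<omega>)) * h (fst \<omega>) \<and>
      c (fst \<omega>, fst (snd \<omega>)) = h (fst \<omega>) * f (fst (snd \<omega>))"
    have eqs: "AE \<omega> in M. A Bar0 \<omega> = (1 - f (fst (snd \<omega>)) * g (snd (snd \<omega>))) / 2 \<and>
      B Bar0 \<omega> = (1 - g (snd (snd \<omega>)) * h (fst \<omega>)) / 2 \<and>
      C Bar0 \<omega> = (1 - h (fst \<omega>) * f (fst (snd \<omega>))) / 2"
      using eq abc by eventually_elim auto
    show thesis
      by (rule that[OF fgh]) (use eqs in simp_all)
  qed simp
qed

text \<open>Each sign is -1 with probability 1/3, so all three are -1 with probability 1/27, and
  then every party outputs bar 1. The three subtracted terms are the probabilities that a given
  party outputs \<open>Bar1_0\<close> on this event; excluding them by the union bound leaves only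
  \<open>Bar1_1\<close> for all parties.\<close>

lemma P_111_lower_bound:
  "P Bar1_1 Bar1_1 Bar1_1 \<ge> 1/27
    - (2 * P Bar1_0 Bar0 Bar0 - (\<Sum>j\<in>{Bar1_0, Bar1_1}. \<Sum>k\<in>{Bar1_0, Bar1_1}. P Bar1_0 j k)) / 3
    - (2 * P Bar0 Bar1_0 Bar0 - (\<Sum>i\<in>{Bar1_0, Bar1_1}. \<Sum>k\<in>{Bar1_0, Bar1_1}. P i Bar1_0 k)) / 3
    - (2 * P Bar0 Bar0 Bar1_0 - (\<Sum>i\<in>{Bar1_0, Bar1_1}. \<Sum>j\<in>{Bar1_0, Bar1_1}. P i j Bar1_0)) / 3"
proof -
  obtain f g h where [measurable]: "f \<in> borel_measurable \<eta>" "g \<in> borel_measurable \<nu>" "h \<in> borel_measurable \<mu>"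
    and fgh: "\<And>y. f y \<in> {-1, 1 :: real}" "\<And>z. g z \<in> {-1, 1 :: real}" "\<And>x. h x \<in> {-1, 1 :: real}"
    and mean: "integral\<^sup>L \<eta> f = 1/3" "integral\<^sup>L \<nu> g = 1/3" "integral\<^sup>L \<mu> h = 1/3"
    and eq: "AE \<omega> in M. A Bar0 \<omega> = (1 - f (fst (snd \<omega>)) * g (snd (snd \<omega>))) / 2"
      "AE \<omega> in M. B Bar0 \<omega> = (1 - g (snd (snd \<omega>)) * h (fst \<omega>)) / 2"
      "AE \<omega> in M. C Bar0 \<omega> = (1 - h (fst \<omega>) * f (fst (snd \<omega>))) / 2"
    using parity_functions by blast
  define F where "F \<omega> = f (fst (snd \<omega>))" for \<omega> :: "'x \<times> 'y \<times> 'z"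
  define G where "G \<omega> = g (snd (snd \<omega>))" for \<omega> :: "'x \<times> 'y \<times> 'z"
  define H where "H \<omega> = h (fst \<omega>)" for \<omega> :: "'x \<times> 'y \<times> 'z"
  have FGH_meas [measurable]: "F \<in> borel_measurable M" "G \<in> borel_measurable M" "H \<in> borel_measurable M"
    unfolding F_def G_def H_def by measurable
  have signs: "F \<omega> \<in> {-1, 1}" "G \<omega> \<in> {-1, 1}" "H \<omega> \<in> {-1, 1}" for \<omega>
    using fgh by (auto simp: F_def G_def H_def)
  have bound: "\<bar>f y\<bar> \<le> 1" "\<bar>g z\<bar> \<le> 1" "\<bar>h x\<bar> \<le> 1" for x y z
    using fgh(1)[of y] fgh(2)[of z] fgh(3)[of x] by auto
  note eq' = eq[folded F_def G_def H_def]
  have XYZ_bound: "\<bar>X i y\<bar> \<le> 1" "\<bar>Y i y'\<bar> \<le> 1" "\<bar>Z i y''\<bar> \<le> 1" for i y y' y''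
    using nonneg X_le_1 Y_le_1 Z_le_1 by (auto simp: abs_le_iff intro: order_trans[of _ 0])
  \<comment> \<open>For each party these say that the sign of the source it does not see factors
    out, with mean 1/3.\<close>
  have indep:
    "(\<integral>\<omega>. A i \<omega> * H \<omega> \<partial>M) = integral\<^sup>L M (A i) / 3"
    "(\<integral>\<omega>. A i \<omega> * G \<omega> * H \<omega> \<partial>M) = (\<integral>\<omega>. A i \<omega> * G \<omega> \<partial>M) / 3"
    "(\<integral>\<omega>. B i \<omega> * F \<omega> \<partial>M) = integral\<^sup>L M (B i) / 3"
    "(\<integral>\<omega>. B i \<omega> * H \<omega> * F \<omega> \<partial>M) = (\<integral>\<omega>. B i \<omega> * H \<omega> \<partial>M) / 3"
    "(\<integral>\<omega>. C i \<omega> * G \<omega> \<partial>M) = integral\<^sup>L M (C i) / 3"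
    "(\<integral>\<omega>. C i \<omega> * F \<omega> * G \<omega> \<partial>M) = (\<integral>\<omega>. C i \<omega> * F \<omega> \<partial>M) / 3" for i
    using integral_mult_alpha[of "X i" h] integral_mult_alpha[of "\<lambda>y. X i y * g (snd y)" h]
      integral_mult_beta[of "Y i" f] integral_mult_beta[of "\<lambda>y. Y i y * h (snd y)" f]
      integral_mult_gamma[of "Z i" g] integral_mult_gamma[of "\<lambda>y. Z i y * f (snd y)" g]
    by (simp_all add: A_def[abs_def] B_def[abs_def] C_def[abs_def] F_def G_def H_def mean bound XYZ_bound abs_mult_le_1)
  \<comment> \<open>\<open>T\<close> is the indicator of the event that all three signs are
    -1.\<close>
  define T where "T \<omega> = (1 - F \<omega>) * (1 - G \<omega>) * (1 - H \<omega>) / 8" for \<omega>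
  have [measurable]: "T \<in> borel_measurable M" unfolding T_def by measurable
  have T01: "T \<omega> \<in> {0, 1}" for \<omega> using signs[of \<omega>] by (auto simp: T_def)
  have int: "integrable M T" "integrable M (\<lambda>\<omega>. A i \<omega> * T \<omega>)" "integrable M (\<lambda>\<omega>. B i \<omega> * T \<omega>)"
    "integrable M (\<lambda>\<omega>. C i \<omega> * T \<omega>)" for i
  proof -
    have "\<bar>T \<omega>\<bar> \<le> 1" "\<bar>A i \<omega> * T \<omega>\<bar> \<le> 1" "\<bar>B i \<omega> * T \<omega>\<bar> \<le> 1" "\<bar>C i \<omega> * T \<omega>\<bar> \<le> 1" for \<omega>
      using T01[of \<omega>] ABC_nonneg[of i \<omega>] ABC_le_1[of i \<omega>] by auto
    then show "integrable M T" "integrable M (\<lambda>\<omega>. A i \<omega> * T \<omega>)" "integrable M (\<lambda>\<omega>. B i \<omega> * T \<omega>)"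
      "integrable M (\<lambda>\<omega>. C i \<omega> * T \<omega>)"
      by (auto intro!: joint.P.integrable_const_bound[where B = 1])
  qed
  have T: "integral\<^sup>L M T = 1/27"
  proof -
    have "integral\<^sup>L M T = (\<integral>\<omega>. (((1 - f (fst (snd \<omega>)))/2) * ((1 - g (snd (snd \<omega>)))/2)) * ((1 - h (fst \<omega>))/2) \<partial>M)"
      unfolding T_def[abs_def] F_def G_def H_def by (simp add: mult.assoc)
    also have "\<dots> = (1/3) * (1/3) * (1/3)"
    proof -
      have b: "\<bar>(1 - f y)/2\<bar> \<le> 1" "\<bar>(1 - g z)/2\<bar> \<le> 1" "\<bar>(1 - h x)/2\<bar> \<le> 1" for x y z
        using fgh(1)[of y] fgh(2)[of z] fgh(3)[of x] by auto
      have i: "integrable \<eta> f" "integrable \<nu> g" "integrable \<mu> h"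
        using bound by (auto intro!: beta.integrable_const_bound[where B = 1]
           gamma.integrable_const_bound[where B = 1] alpha.integrable_const_bound[where B = 1])
      have m: "(\<integral>y. (1 - f y)/2 \<partial>\<eta>) = 1/3" "(\<integral>z. (1 - g z)/2 \<partial>\<nu>) = 1/3" "(\<integral>x. (1 - h x)/2 \<partial>\<mu>) = 1/3"
        using i mean by (simp_all add: alpha.prob_space beta.prob_space gamma.prob_space)
      have "(\<integral>\<omega>. (1 - f (fst (snd \<omega>)))/2 \<partial>M) = 1/3"
        using integral_mult_beta[of "\<lambda>_. 1" "\<lambda>y. (1 - f y)/2"] b m by (simp add: joint.P.prob_space del: integral_divide_zero)
      moreover have "(\<integral>\<omega>. ((1 - f (fst (snd \<omega>)))/2) * ((1 - g (snd (snd \<omega>)))/2) \<partial>M)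
         = (\<integral>\<omega>. (1 - f (fst (snd \<omega>)))/2 \<partial>M) * (1/3)"
        using integral_mult_gamma[of "\<lambda>y. (1 - f (snd y))/2" "\<lambda>z. (1 - g z)/2"] b m by (simp del: integral_divide_zero)
      moreover have "(\<integral>\<omega>. (((1 - f (fst (snd \<omega>)))/2) * ((1 - g (snd (snd \<omega>)))/2)) * ((1 - h (fst \<omega>))/2) \<partial>M) =
         (\<integral>\<omega>. ((1 - f (fst (snd \<omega>)))/2) * ((1 - g (snd (snd \<omega>)))/2) \<partial>M) * (1/3)"
        using integral_mult_alpha[of "\<lambda>y. ((1 - f (fst y))/2) * ((1 - g (snd y))/2)" "\<lambda>x. (1 - h x)/2"] b m
        by (simp add: abs_mult_le_1 del: integral_divide_zero times_divide_eq_left times_divide_eq_right)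
      ultimately show ?thesis by (simp del: integral_divide_zero)
    qed
    finally show ?thesis by simp
  qed
  have le1: "A Bar1_0 \<omega> + A Bar0 \<omega> \<le> 1" "B Bar1_0 \<omega> + B Bar0 \<omega> \<le> 1" "C Bar1_0 \<omega> + C Bar0 \<omega> \<le> 1" for \<omega>
    using ABC_total[of \<omega>] ABC_nonneg[of Bar1_1 \<omega>] by linarith+
  have "(\<integral>\<omega>. A Bar1_0 \<omega> * T \<omega> \<partial>M) =
    (2 * (\<integral>\<omega>. A Bar1_0 \<omega> * B Bar0 \<omega> * C Bar0 \<omega> \<partial>M)
      - (\<integral>\<omega>. A Bar1_0 \<omega> * (1 - B Bar0 \<omega>) * (1 - C Bar0 \<omega>) \<partial>M)) / 3"
    unfolding T_def
    by (rule joint.P.restricted_marginal[OF ABC_meas(1) ABC_meas(2) ABC_meas(3)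
      FGH_meas(1) FGH_meas(2) FGH_meas(3) signs(1) signs(2) signs(3)
      ABC_nonneg(1) le1(1) ABC_nonneg(1) eq'(1) eq'(2) eq'(3) indep(1) indep(2)])
  also have "(\<integral>\<omega>. A Bar1_0 \<omega> * (1 - B Bar0 \<omega>) * (1 - C Bar0 \<omega>) \<partial>M) =
      (\<Sum>j\<in>{Bar1_0, Bar1_1}. \<Sum>k\<in>{Bar1_0, Bar1_1}. P Bar1_0 j k)"
    by (simp add: ABC_total P_integral distrib_left distrib_right)
  finally have 1: "(\<integral>\<omega>. A Bar1_0 \<omega> * T \<omega> \<partial>M) =
    (2 * P Bar1_0 Bar0 Bar0 - (\<Sum>j\<in>{Bar1_0, Bar1_1}. \<Sum>k\<in>{Bar1_0, Bar1_1}. P Bar1_0 j k)) / 3"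
    unfolding P_integral[symmetric] .
  \<comment> \<open>The other two parties follow from the same lemma by cyclic rotation, after
    reordering the factors of \<open>T\<close>.\<close>
  have "(\<integral>\<omega>. B Bar1_0 \<omega> * T \<omega> \<partial>M) = (\<integral>\<omega>. B Bar1_0 \<omega> * ((1 - G \<omega>) * (1 - H \<omega>) * (1 - F \<omega>) / 8) \<partial>M)"
    by (simp add: T_def mult_ac)
  also have "\<dots> = (2 * (\<integral>\<omega>. B Bar1_0 \<omega> * C Bar0 \<omega> * A Bar0 \<omega> \<partial>M)
      - (\<integral>\<omega>. B Bar1_0 \<omega> * (1 - C Bar0 \<omega>) * (1 - A Bar0 \<omega>) \<partial>M)) / 3"
    by (rule joint.P.restricted_marginal[OF ABC_meas(2) ABC_meas(3) ABC_meas(1)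
      FGH_meas(2) FGH_meas(3) FGH_meas(1) signs(2) signs(3) signs(1)
      ABC_nonneg(2) le1(2) ABC_nonneg(2) eq'(2) eq'(3) eq'(1) indep(3) indep(4)])
  also have "(\<integral>\<omega>. B Bar1_0 \<omega> * C Bar0 \<omega> * A Bar0 \<omega> \<partial>M) = P Bar0 Bar1_0 Bar0"
    by (simp add: P_integral mult_ac)
  also have "(\<integral>\<omega>. B Bar1_0 \<omega> * (1 - C Bar0 \<omega>) * (1 - A Bar0 \<omega>) \<partial>M) =
     (\<integral>\<omega>. (1 - A Bar0 \<omega>) * B Bar1_0 \<omega> * (1 - C Bar0 \<omega>) \<partial>M)"
    by (simp only: mult_ac)
  also have "\<dots> = (\<Sum>i\<in>{Bar1_0, Bar1_1}. \<Sum>k\<in>{Bar1_0, Bar1_1}. P i Bar1_0 k)"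
    by (simp add: ABC_total P_integral distrib_left distrib_right)
  finally have 2: "(\<integral>\<omega>. B Bar1_0 \<omega> * T \<omega> \<partial>M) =
    (2 * P Bar0 Bar1_0 Bar0 - (\<Sum>i\<in>{Bar1_0, Bar1_1}. \<Sum>k\<in>{Bar1_0, Bar1_1}. P i Bar1_0 k)) / 3" .
  have "(\<integral>\<omega>. C Bar1_0 \<omega> * T \<omega> \<partial>M) = (\<integral>\<omega>. C Bar1_0 \<omega> * ((1 - H \<omega>) * (1 - F \<omega>) * (1 - G \<omega>) / 8) \<partial>M)"
    by (simp add: T_def mult_ac)
  also have "\<dots> = (2 * (\<integral>\<omega>. C Bar1_0 \<omega> * A Bar0 \<omega> * B Bar0 \<omega> \<partial>M)
      - (\<integral>\<omega>. C Bar1_0 \<omega> * (1 - A Bar0 \<omega>) * (1 - B Bar0 \<omega>) \<partial>M)) / 3"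
    by (rule joint.P.restricted_marginal[OF ABC_meas(3) ABC_meas(1) ABC_meas(2)
      FGH_meas(3) FGH_meas(1) FGH_meas(2) signs(3) signs(1) signs(2)
      ABC_nonneg(3) le1(3) ABC_nonneg(3) eq'(3) eq'(1) eq'(2) indep(5) indep(6)])
  also have "(\<integral>\<omega>. C Bar1_0 \<omega> * A Bar0 \<omega> * B Bar0 \<omega> \<partial>M) = P Bar0 Bar0 Bar1_0"
    by (simp add: P_integral mult_ac)
  also have "(\<integral>\<omega>. C Bar1_0 \<omega> * (1 - A Bar0 \<omega>) * (1 - B Bar0 \<omega>) \<partial>M) =
     (\<integral>\<omega>. (1 - A Bar0 \<omega>) * (1 - B Bar0 \<omega>) * C Bar1_0 \<omega> \<partial>M)"
    by (simp only: mult_ac)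
  also have "\<dots> = (\<Sum>i\<in>{Bar1_0, Bar1_1}. \<Sum>j\<in>{Bar1_0, Bar1_1}. P i j Bar1_0)"
    by (simp add: ABC_total P_integral distrib_left distrib_right)
  finally have 3: "(\<integral>\<omega>. C Bar1_0 \<omega> * T \<omega> \<partial>M) =
    (2 * P Bar0 Bar0 Bar1_0 - (\<Sum>i\<in>{Bar1_0, Bar1_1}. \<Sum>j\<in>{Bar1_0, Bar1_1}. P i j Bar1_0)) / 3" .
  \<comment> \<open>The union bound holds pointwise: where \<open>T\<close> is 0 the left side
    vanishes, and where \<open>T\<close> is 1 no party can output \<open>Bar0\<close>, so the
    responses for \<open>Bar1_1\<close> and \<open>Bar1_0\<close> are complementary.\<close>
  have "(\<integral>\<omega>. T \<omega> - A Bar1_0 \<omega> * T \<omega> - B Bar1_0 \<omega> * T \<omega> - C Bar1_0 \<omega> * T \<omega> \<partial>M) \<le> P Bar1_1 Bar1_1 Bar1_1"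
    unfolding P_integral
  proof (rule integral_mono_AE)
    show "AE \<omega> in M. T \<omega> - A Bar1_0 \<omega> * T \<omega> - B Bar1_0 \<omega> * T \<omega> - C Bar1_0 \<omega> * T \<omega>
        \<le> A Bar1_1 \<omega> * B Bar1_1 \<omega> * C Bar1_1 \<omega>"
      using eq'
    proof eventually_elim
      case (elim \<omega>)
      show ?case
      proof (cases "T \<omega> = 0")
        case True
        then show ?thesis by (simp add: ABC_nonneg)
      next
        case False
        then have FGH: "T \<omega> = 1" "F \<omega> = -1" "G \<omega> = -1" "H \<omega> = -1"
          using signs[of \<omega>] T01[of \<omega>] by (auto simp: T_def)
        then have *: "A Bar1_1 \<omega> = 1 - A Bar1_0 \<omega>" "B Bar1_1 \<omega> = 1 - B Bar1_0 \<omega>" "C Bar1_1 \<omega> = 1 - C Bar1_0 \<omega>"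
          using elim ABC_total[of \<omega>] by auto
        have union_bound: "1 - x - y - z \<le> (1 - x) * (1 - y) * (1 - z)"
          if "0 \<le> x" "x \<le> 1" "0 \<le> y" "y \<le> 1" "0 \<le> z" "z \<le> 1" for x y z :: real
        proof -
          \<comment> \<open>This expression is the difference of the two sides.\<close>
          have "0 \<le> x * y * (1 - z) + x * z + y * z" using that by simp
          then show ?thesis by (simp add: algebra_simps)
        qed
        show ?thesis unfolding * FGH using ABC_nonneg ABC_le_1 by (simp add: union_bound)
      qed
    qed
  qed (use int in auto)
  then show ?thesis using int T 1 2 3 by simp
qed

end

section \<open>Nonlocality\<close>

text \<open>Summing over the outcomes of two parties uses that (u, v) and (v, -u) are orthonormal:
  the interference terms cancel and only the weights of the remaining party survive.\<close>

lemma sum_P_Q333: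
  assumes norm: "u\<^sup>2 + v\<^sup>2 = 1"
  shows
    "(\<Sum>j\<in>{Bar1_0, Bar1_1}. \<Sum>k\<in>{Bar1_0, Bar1_1}. P_Q333 l\<^sub>0 l\<^sub>1 u v Bar1_0 j k) = (l\<^sub>1 ^ 3)\<^sup>2 * u\<^sup>2 + (l\<^sub>0 ^ 3)\<^sup>2 * v\<^sup>2"
    "(\<Sum>i\<in>{Bar1_0, Bar1_1}. \<Sum>k\<in>{Bar1_0, Bar1_1}. P_Q333 l\<^sub>0 l\<^sub>1 u v i Bar1_0 k) = (l\<^sub>1 ^ 3)\<^sup>2 * u\<^sup>2 + (l\<^sub>0 ^ 3)\<^sup>2 * v\<^sup>2"
    "(\<Sum>i\<in>{Bar1_0, Bar1_1}. \<Sum>j\<in>{Bar1_0, Bar1_1}. P_Q333 l\<^sub>0 l\<^sub>1 u v i j Bar1_0) = (l\<^sub>1 ^ 3)\<^sup>2 * u\<^sup>2 + (l\<^sub>0 ^ 3)\<^sup>2 * v\<^sup>2"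
proof -
  define p q where "p = l\<^sub>1 ^ 3" and "q = l\<^sub>0 ^ 3"
  have expand: "(p * u * u * u + q * v * v * v)\<^sup>2 + 2 * (p * u * u * v - q * v * v * u)\<^sup>2 + (p * u * v * v + q * v * u * u)\<^sup>2
      = p\<^sup>2 * u\<^sup>2 + q\<^sup>2 * v\<^sup>2" (is "?l = _")
  proof -
    \<comment> \<open>The norm condition is inserted as a factor to make this a polynomial identity,
      homogeneous of degree 6 in \<open>u\<close> and \<open>v\<close>.\<close>
    have "?l = (p\<^sup>2 * u\<^sup>2 + q\<^sup>2 * v\<^sup>2) * (u\<^sup>2 + v\<^sup>2)\<^sup>2"
      by (simp add: power2_eq_square algebra_simps)
    then show ?thesis by (simp add: norm)
  qed
  show "(\<Sum>j\<in>{Bar1_0, Bar1_1}. \<Sum>k\<in>{Bar1_0, Bar1_1}. P_Q333 l\<^sub>0 l\<^sub>1 u v Bar1_0 j k) = (l\<^sub>1 ^ 3)\<^sup>2 * u\<^sup>2 + (l\<^sub>0 ^ 3)\<^sup>2 * v\<^sup>2"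
    "(\<Sum>i\<in>{Bar1_0, Bar1_1}. \<Sum>k\<in>{Bar1_0, Bar1_1}. P_Q333 l\<^sub>0 l\<^sub>1 u v i Bar1_0 k) = (l\<^sub>1 ^ 3)\<^sup>2 * u\<^sup>2 + (l\<^sub>0 ^ 3)\<^sup>2 * v\<^sup>2"
    "(\<Sum>i\<in>{Bar1_0, Bar1_1}. \<Sum>j\<in>{Bar1_0, Bar1_1}. P_Q333 l\<^sub>0 l\<^sub>1 u v i j Bar1_0) = (l\<^sub>1 ^ 3)\<^sup>2 * u\<^sup>2 + (l\<^sub>0 ^ 3)\<^sup>2 * v\<^sup>2"
    unfolding p_def[symmetric] q_def[symmetric] expand[symmetric]
    by (simp_all add: P_Q333_three p_def q_def mult_ac)
qed

lemma pmf_outcome_sum: "pmf p Bar0 + pmf p Bar1_0 + pmf p Bar1_1 = 1"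
proof -
  have "(\<Sum>i\<in>{Bar0, Bar1_0, Bar1_1}. pmf p i) = 1"
    by (rule sum_pmf_eq_1) (auto intro: outcome.exhaust)
  then show ?thesis by simp
qed

theorem theorem2:
  fixes u v :: real
  assumes "u > 0" and "v > 0"
    and "u\<^sup>2 + v\<^sup>2 = 1"
    and "2 / 3 < u\<^sup>2" and "u\<^sup>2 < 1"
  shows "\<not> triangle_local TYPE('x) TYPE('y) TYPE('z)
    (P_Q333 (sqrt (1 / 3)) (sqrt (2 / 3)) u v)"
proof
  define l\<^sub>0 l\<^sub>1 where "l\<^sub>0 = sqrt (1/3)" and "l\<^sub>1 = sqrt (2/3)"
  let ?P = "P_Q333 l\<^sub>0 l\<^sub>1 u v"
  have l2: "l\<^sub>0\<^sup>2 = 1/3" "l\<^sub>1\<^sup>2 = 2/3" unfolding l\<^sub>0_def l\<^sub>1_def by (simp_all del: real_sqrt_divide)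
  have pow: "y ^ 4 = (y\<^sup>2)\<^sup>2" "(y ^ 3)\<^sup>2 = (y\<^sup>2) ^ 3" for y :: real by (simp_all flip: power_mult)
  have l4: "l\<^sub>0 ^ 4 = 1/9" "l\<^sub>1 ^ 4 = 4/9" "(l\<^sub>0 ^ 3)\<^sup>2 = 1/27" "(l\<^sub>1 ^ 3)\<^sup>2 = 8/27"
    unfolding pow l2 by (simp_all add: power2_eq_square power3_eq_cube)
  assume "triangle_local TYPE('x) TYPE('y) TYPE('z) (P_Q333 (sqrt (1 / 3)) (sqrt (2 / 3)) u v)"
  then obtain \<mu> :: "'x measure" and \<eta> :: "'y measure" and \<nu> :: "'z measure" and P\<^sub>A P\<^sub>B P\<^sub>C
    where prob: "prob_space \<mu>" "prob_space \<eta>" "prob_space \<nu>"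
    and meas: "\<And>a. (\<lambda>(\<beta>, \<gamma>). pmf (P\<^sub>A \<beta> \<gamma>) a) \<in> borel_measurable (\<eta> \<Otimes>\<^sub>M \<nu>)"
      "\<And>b. (\<lambda>(\<gamma>, \<alpha>). pmf (P\<^sub>B \<gamma> \<alpha>) b) \<in> borel_measurable (\<nu> \<Otimes>\<^sub>M \<mu>)"
      "\<And>c. (\<lambda>(\<alpha>, \<beta>). pmf (P\<^sub>C \<alpha> \<beta>) c) \<in> borel_measurable (\<mu> \<Otimes>\<^sub>M \<eta>)"
    and P: "\<And>a b c. ?P a b c = (\<integral>(\<alpha>, \<beta>, \<gamma>). pmf (P\<^sub>A \<beta> \<gamma>) a * pmf (P\<^sub>B \<gamma> \<alpha>) b * pmf (P\<^sub>C \<alpha> \<beta>) c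
          \<partial>(\<mu> \<Otimes>\<^sub>M (\<eta> \<Otimes>\<^sub>M \<nu>)))"
    unfolding triangle_local_def l\<^sub>0_def[symmetric] l\<^sub>1_def[symmetric] by blast
  have v: "u\<^sup>2 = 1 - v\<^sup>2" using assms(3) by simp
  interpret token_model \<mu> \<eta> \<nu> "\<lambda>i (\<beta>, \<gamma>). pmf (P\<^sub>A \<beta> \<gamma>) i"
    "\<lambda>i (\<gamma>, \<alpha>). pmf (P\<^sub>B \<gamma> \<alpha>) i" "\<lambda>i (\<alpha>, \<beta>). pmf (P\<^sub>C \<alpha> \<beta>) i" ?P
  proof (intro token_model.intro triangle_model.intro three_sources.intro prob
      triangle_model_axioms.intro token_model_axioms.intro meas)
    show "?P i j k = (\<integral>\<omega>. (case snd \<omega> of (\<beta>, \<gamma>) \<Rightarrow> pmf (P\<^sub>A \<beta> \<gamma>) i) *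
        (case (snd (snd \<omega>), fst \<omega>) of (\<gamma>, \<alpha>) \<Rightarrow> pmf (P\<^sub>B \<gamma> \<alpha>) j) *
        (case (fst \<omega>, fst (snd \<omega>)) of (\<alpha>, \<beta>) \<Rightarrow> pmf (P\<^sub>C \<alpha> \<beta>) k) \<partial>(\<mu> \<Otimes>\<^sub>M (\<eta> \<Otimes>\<^sub>M \<nu>)))" for i j k
      by (simp add: P case_prod_beta')
  qed (auto simp: pmf_outcome_sum[unfolded add.assoc] P_Q333_zero P_Q333_one l2 l4 v field_simps)
  \<comment> \<open>The terms in \<open>u\<^sup>2\<close> cancel. After division by 3 each party
    contributes \<open>v\<^sup>2 / 27\<close>, so the lower bound becomes
    \<open>(1 - 3 * v\<^sup>2) / 27\<close>.\<close>
  have marginals: "2 * ?P Bar1_0 Bar0 Bar0 - (8/27 * u\<^sup>2 + 1/27 * v\<^sup>2) = v\<^sup>2 / 9"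
    "2 * ?P Bar0 Bar1_0 Bar0 - (8/27 * u\<^sup>2 + 1/27 * v\<^sup>2) = v\<^sup>2 / 9"
    "2 * ?P Bar0 Bar0 Bar1_0 - (8/27 * u\<^sup>2 + 1/27 * v\<^sup>2) = v\<^sup>2 / 9"
    by (simp_all add: P_Q333_one l2 l4 field_simps)
  have "(1 - 3 * v\<^sup>2) / 27 \<le> ?P Bar1_1 Bar1_1 Bar1_1"
    using P_111_lower_bound unfolding sum_P_Q333[OF assms(3)] l4 marginals by (simp add: field_simps)
  \<comment> \<open>The minus sign comes from the coefficient \<open>- u\<close> of the second bar 1
    vector, and this destructive interference pushes the probability below the local bound.\<close>
  also have "\<dots> = (l\<^sub>1 ^ 3 * v ^ 3 - l\<^sub>0 ^ 3 * u ^ 3)\<^sup>2"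
    by (simp add: P_Q333_three power3_eq_cube mult_ac)
  also have "\<dots> < (1 - 3 * v\<^sup>2) / 27"
    unfolding l\<^sub>0_def l\<^sub>1_def by (rule all_ones_amplitude_bound[OF assms])
  finally show False by simp
qed

end
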